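(* Let $G$ be a connected hypergraph. Then $\chi_{\mathrm{DP}}(G)\le\Delta(G)+1$, and equality holds if and only if $G$ is a DP-hyperbrick, i.e. $G=tK_n$ for some $t,n\ge1$, or $G=tC_n$ for some $t\ge1$, $n\ge3$, or $G$ consists of a single edge $e$ with $V(G)=i_G(e)$.
   Context: A hypergraph $G=(V,E,i)$ has finite vertex and edge sets and $i:E\to2^V$ with $|i(e)|\ge2$; parallel edges allowed. $d_G(v)$ is the number of edges containing $v$ and $\Delta(G)$ the maximum degree. $G[Y]$ is the induced subhypergraph on $Y$ (edges $e$ with $i(e)\subseteq Y$); $Y$ independent if $G[Y]$ has no edges. $G$ is connected if any two vertices are joined by a sequence of distinct vertices $v_1,\dots,v_{q+1}$ and distinct edges $e_1,\dots,e_q$ with $\{v_j,v_{j+1}\}\subseteq i(e_j)$. $tK_n$ and $tC_n$ denote the complete graph and cycle on $n$ vertices with each edge replaced by $t$ parallel ordinary (2-vertex) edges. Cover $(X,H)$ of $G$: pairwise disjoint sets $X_v$ ($v\in V(G)$); $H$ a hypergraph with $V(H)=\bigcup X_v$, each $X_v$ independent in $H$, and for each $e\in E(G)$ a possibly empty matching $M_e$ (pairwise vertex-disjoint edges) in $H[\bigcup_{v\in i(e)}X_v]$ whose edges meet each $X_v$, $v\in i(e)$, in exactly one vertex, with $E(H)=\bigcup M_e$. $G$ is $(X,H)$-colorable if there is an independent set $T$ of $H$ with $|T\cap X_v|=1$ for all $v$. The DP-chromatic number $\chi_{\mathrm{DP}}(G)$ is the least $k\ge0$ such that $G$ is $(X,H)$-colorable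 for every cover $(X,H)$ with $|X_v|\ge k$ for all $v$. *)

theory Defs
  imports Main
begin

record ('v, 'e) hypergraph_rec =
  verts :: "'v set"
  edges :: "'e set"
  inc   :: "'e \<Rightarrow> 'v set"

text \<open>
  Edges are names with an incidence map, so parallel edges are allowed. The empty
  hypergraph is not excluded.
\<close>

locale hypergraph =
  fixes G :: "('v, 'e) hypergraph_rec"
  assumes finite_verts: "finite (verts G)"
    and finite_edges: "finite (edges G)"
    and inc_subset: "e \<in> edges G \<Longrightarrow> inc G e \<subseteq> verts G"
    and card_inc: "e \<in> edges G \<Longrightarrow> card (inc G e) \<ge> 2"

definition degree :: "('v, 'e) hypergraph_rec \<Rightarrow> 'v \<Rightarrow> nat" where
  "degree G v = card {e \<in> edges G. v \<in> inc G e}"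

text \<open>Inserting \<open>0\<close> only matters for the empty hypergraph, whose maximum degree is \<open>0\<close>.\<close>

definition max_degree :: "('v, 'e) hypergraph_rec \<Rightarrow> nat" where
  "max_degree G = Max (insert 0 (degree G ` verts G))"

definition induced :: "('v, 'e) hypergraph_rec \<Rightarrow> 'v set \<Rightarrow> ('v, 'e) hypergraph_rec" where
  "induced G Y = \<lparr>verts = Y, edges = {e \<in> edges G. inc G e \<subseteq> Y}, inc = inc G\<rparr>"

definition independent :: "('v, 'e) hypergraph_rec \<Rightarrow> 'v set \<Rightarrow> bool" where
  "independent G Y \<longleftrightarrow> Y \<subseteq> verts G \<and> edges (induced G Y) = {}"

definition joined :: "('v, 'e) hypergraph_rec \<Rightarrow> 'v \<Rightarrow> 'v \<Rightarrow> bool" where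
  "joined G u w \<longleftrightarrow> (\<exists>vs es.
     length vs = Suc (length es) \<and>
     set vs \<subseteq> verts G \<and> distinct vs \<and>
     set es \<subseteq> edges G \<and> distinct es \<and>
     hd vs = u \<and> last vs = w \<and>
     (\<forall>j < length es. {vs ! j, vs ! Suc j} \<subseteq> inc G (es ! j)))"

definition connected_hypergraph :: "('v, 'e) hypergraph_rec \<Rightarrow> bool" where
  "connected_hypergraph G \<longleftrightarrow> (\<forall>u \<in> verts G. \<forall>w \<in> verts G. joined G u w)"

definition matching :: "('v, 'e) hypergraph_rec \<Rightarrow> 'e set \<Rightarrow> bool" where
  "matching G M \<longleftrightarrow> M \<subseteq> edges G \<and>
     (\<forall>e \<in> M. \<forall>f \<in> M. e \<noteq> f \<longrightarrow> inc G e \<inter> inc G f = {})"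

definition is_cover ::
  "('v, 'e) hypergraph_rec \<Rightarrow> ('v \<Rightarrow> 'x set) \<Rightarrow> ('x, 'f) hypergraph_rec \<Rightarrow> bool" where
  "is_cover G X H \<longleftrightarrow>
     hypergraph H \<and>
     (\<forall>u \<in> verts G. \<forall>v \<in> verts G. u \<noteq> v \<longrightarrow> X u \<inter> X v = {}) \<and>
     verts H = (\<Union>v \<in> verts G. X v) \<and>
     (\<forall>v \<in> verts G. independent H (X v)) \<and>
     (\<exists>M. (\<forall>e \<in> edges G.
              matching (induced H (\<Union>v \<in> inc G e. X v)) (M e) \<and>
              (\<forall>f \<in> M e. \<forall>v \<in> inc G e. card (inc H f \<inter> X v) = 1)) \<and>
          edges H = (\<Union>e \<in> edges G. M e))"

definition cover_colorable ::
  "('v, 'e) hypergraph_rec \<Rightarrow> ('v \<Rightarrow> 'x set) \<Rightarrow> ('x, 'f) hypergraph_rec \<Rightarrow> bool" where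
  "cover_colorable G X H \<longleftrightarrow>
     (\<exists>T. independent H T \<and> (\<forall>v \<in> verts G. card (T \<inter> X v) = 1))"

text \<open>
  A definition cannot quantify over types, so covers range over hypergraphs whose vertices
  and edges are natural numbers. As cover hypergraphs are finite this loses nothing; see
  \<open>dp_colorable_any_cover\<close>.
\<close>

definition dp_colorable :: "('v, 'e) hypergraph_rec \<Rightarrow> nat \<Rightarrow> bool" where
  "dp_colorable G k \<longleftrightarrow>
     (\<forall>(X :: 'v \<Rightarrow> nat set) (H :: (nat, nat) hypergraph_rec).
        is_cover G X H \<and> (\<forall>v \<in> verts G. card (X v) \<ge> k) \<longrightarrow> cover_colorable G X H)"

definition dp_chromatic_number :: "('v, 'e) hypergraph_rec \<Rightarrow> nat" where
  "dp_chromatic_number G = (LEAST k. dp_colorable G k)"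

definition hypergraph_iso ::
  "('v, 'e) hypergraph_rec \<Rightarrow> ('w, 'f) hypergraph_rec \<Rightarrow> bool" where
  "hypergraph_iso G H \<longleftrightarrow> (\<exists>\<phi> \<psi>.
     bij_betw \<phi> (verts G) (verts H) \<and> bij_betw \<psi> (edges G) (edges H) \<and>
     (\<forall>e \<in> edges G. inc H (\<psi> e) = \<phi> ` inc G e))"

text \<open>The simple graph \<open>(V, F)\<close> with each edge replaced by \<open>t\<close> parallel edges.\<close>

definition multiple_graph :: "nat \<Rightarrow> 'v set \<Rightarrow> 'v set set \<Rightarrow> ('v, 'v set \<times> nat) hypergraph_rec" where
  "multiple_graph t V F = \<lparr>verts = V, edges = F \<times> {..<t}, inc = fst\<rparr>"

definition tK :: "nat \<Rightarrow> nat \<Rightarrow> (nat, nat set \<times> nat) hypergraph_rec" where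
  "tK t n = multiple_graph t {..<n} {{i, j} | i j. i < n \<and> j < n \<and> i \<noteq> j}"

definition tC :: "nat \<Rightarrow> nat \<Rightarrow> (nat, nat set \<times> nat) hypergraph_rec" where
  "tC t n = multiple_graph t {..<n} {{i, Suc i mod n} | i. i < n}"

definition dp_hyperbrick :: "('v, 'e) hypergraph_rec \<Rightarrow> bool" where
  "dp_hyperbrick G \<longleftrightarrow>
     (\<exists>t n. t \<ge> 1 \<and> n \<ge> 1 \<and> hypergraph_iso G (tK t n)) \<or>
     (\<exists>t n. t \<ge> 1 \<and> n \<ge> 3 \<and> hypergraph_iso G (tC t n)) \<or>
     (\<exists>e. edges G = {e} \<and> verts G = inc G e)"

lemma dp_colorable_any_cover:
  fixes G :: "('v, 'e) hypergraph_rec" and H :: "('x, 'f) hypergraph_rec"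
  assumes G: "hypergraph G" and k: "dp_colorable G k"
    and cov: "is_cover G X H" and large: "\<forall>v \<in> verts G. card (X v) \<ge> k"
  shows "cover_colorable G X H"
proof -
  interpret G: hypergraph G by (rule G)
  interpret H: hypergraph H using cov unfolding is_cover_def by (rule conjunct1)
  obtain f :: "'x \<Rightarrow> nat" where f: "inj_on f (verts H)"
    using finite_imp_inj_to_nat_seg[OF H.finite_verts] by metis
  obtain g :: "'f \<Rightarrow> nat" where g: "inj_on g (edges H)"
    using finite_imp_inj_to_nat_seg[OF H.finite_edges] by metis
  define g' where "g' = the_inv_into (edges H) g"
  have g'g: "g' (g e) = e" if "e \<in> edges H" for e
    using the_inv_into_f_f[OF g that] by (simp add: g'_def)
  define H' where "H' = \<lparr>verts = f ` verts H, edges = g ` edges H, inc = (\<lambda>e. f ` inc H (g' e))\<rparr>"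
  define X' where "X' v = f ` X v" for v
  have H'_simps: "verts H' = f ` verts H" "edges H' = g ` edges H" "inc H' e = f ` inc H (g' e)" for e
    by (simp_all add: H'_def)
  obtain M where
    disj0: "\<forall>u \<in> verts G. \<forall>v \<in> verts G. u \<noteq> v \<longrightarrow> X u \<inter> X v = {}" and
    VH: "verts H = (\<Union>v \<in> verts G. X v)" and
    indX: "\<forall>v \<in> verts G. independent H (X v)" and
    M: "\<forall>e \<in> edges G. matching (induced H (\<Union>v \<in> inc G e. X v)) (M e) \<and>
          (\<forall>h \<in> M e. \<forall>v \<in> inc G e. card (inc H h \<inter> X v) = 1)" and
    M3: "edges H = (\<Union>e \<in> edges G. M e)"
    using cov unfolding is_cover_def by (elim conjE exE) (rule that)
  have disj: "X u \<inter> X v = {}" if "u \<in> verts G" "v \<in> verts G" "u \<noteq> v" for u v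
    using disj0 that by simp
  have XV: "X v \<subseteq> verts H" if "v \<in> verts G" for v
    unfolding VH using that by (rule UN_upper)
  have M1: "matching (induced H (\<Union>v \<in> inc G e. X v)) (M e)" if "e \<in> edges G" for e
    using bspec[OF M that] by (rule conjunct1)
  have M2: "card (inc H h \<inter> X v) = 1" if "e \<in> edges G" "h \<in> M e" "v \<in> inc G e" for e h v
    using conjunct2[OF bspec[OF M that(1)]] that by simp
  have sub_iff: "f ` A \<subseteq> f ` B \<longleftrightarrow> A \<subseteq> B" if "A \<subseteq> verts H" "B \<subseteq> verts H" for A B
  proof
    assume sub: "f ` A \<subseteq> f ` B"
    show "A \<subseteq> B"
    proof
      fix x assume x: "x \<in> A"
      with sub have "f x \<in> f ` B" by (rule subsetD[OF _ imageI])
      then show "x \<in> B"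
        using inj_on_image_mem_iff[OF f subsetD[OF that(1) x] that(2)] by (rule iffD1[rotated])
    qed
  qed (rule image_mono)
  have int_eq: "f ` A \<inter> f ` B = f ` (A \<inter> B)" if "A \<subseteq> verts H" "B \<subseteq> verts H" for A B
    using inj_on_image_Int[OF f that] by simp
  have card_eq: "card (f ` A) = card A" if "A \<subseteq> verts H" for A
    using card_image[OF inj_on_subset[OF f that]] .
  have ind_iff: "independent H' (f ` A) \<longleftrightarrow> independent H A" if "A \<subseteq> verts H" for A
  proof -
    have "f ` A \<subseteq> f ` verts H" using that by (rule image_mono)
    moreover have "inc H' (g e) \<subseteq> f ` A \<longleftrightarrow> inc H e \<subseteq> A" if "e \<in> edges H" for e
      unfolding H'_simps(3) g'g[OF that] by (rule sub_iff[OF H.inc_subset[OF that] \<open>A \<subseteq> verts H\<close>])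
    then have "{e \<in> edges H'. inc H' e \<subseteq> f ` A} = {} \<longleftrightarrow> {e \<in> edges H. inc H e \<subseteq> A} = {}"
      unfolding H'_simps(2) by blast
    ultimately show ?thesis
      using that by (simp add: independent_def induced_def H'_simps(1) del: Collect_empty_eq)
  qed
  have "is_cover G X' H'"
    unfolding is_cover_def
  proof (intro conjI ballI impI)
    show "hypergraph H'"
    proof
      show "finite (verts H')" "finite (edges H')"
        by (simp_all add: H'_simps H.finite_verts H.finite_edges)
      fix h assume "h \<in> edges H'"
      then obtain a where a: "a \<in> edges H" "h = g a" by (auto simp: H'_simps)
      show "inc H' h \<subseteq> verts H'"
        using H.inc_subset[OF a(1)] by (simp add: H'_simps a g'g image_mono)
      show "card (inc H' h) \<ge> 2"
        using H.card_inc[OF a(1)] H.inc_subset[OF a(1)] by (simp add: H'_simps a g'g card_eq)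
    qed
    show "X' u \<inter> X' v = {}" if "u \<in> verts G" "v \<in> verts G" "u \<noteq> v" for u v
      using that by (simp add: X'_def int_eq XV disj)
    show "verts H' = (\<Union>v \<in> verts G. X' v)"
      by (simp add: H'_simps X'_def VH image_UN)
    show "independent H' (X' v)" if "v \<in> verts G" for v
      using that by (simp add: X'_def ind_iff XV indX)
    show "\<exists>M. (\<forall>e \<in> edges G. matching (induced H' (\<Union>v \<in> inc G e. X' v)) (M e) \<and>
              (\<forall>f \<in> M e. \<forall>v \<in> inc G e. card (inc H' f \<inter> X' v) = 1)) \<and>
          edges H' = (\<Union>e \<in> edges G. M e)"
    proof (intro exI[of _ "\<lambda>e. g ` M e"] conjI ballI)
      fix e assume e: "e \<in> edges G"
      have ME: "M e \<subseteq> edges H" using M3 e by blast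
      have U: "(\<Union>v \<in> inc G e. X' v) = f ` (\<Union>v \<in> inc G e. X v)"
        by (simp add: X'_def image_UN)
      show "matching (induced H' (\<Union>v \<in> inc G e. X' v)) (g ` M e)"
        unfolding matching_def
      proof (intro conjI ballI impI)
        show "g ` M e \<subseteq> edges (induced H' (\<Union>v \<in> inc G e. X' v))"
        proof
          fix h assume "h \<in> g ` M e"
          then obtain h0 where h0: "h0 \<in> M e" "h = g h0" by blast
          have "inc H h0 \<subseteq> (\<Union>v \<in> inc G e. X v)" "h0 \<in> edges H"
            using M1[OF e] h0 by (auto simp: matching_def induced_def)
          then show "h \<in> edges (induced H' (\<Union>v \<in> inc G e. X' v))"
            unfolding U by (simp add: induced_def H'_simps h0 g'g image_mono)
        qed
        fix h h' assume "h \<in> g ` M e" "h' \<in> g ` M e" and ne: "h \<noteq> h'"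
        then obtain a b where ab: "a \<in> M e" "b \<in> M e" "h = g a" "h' = g b" by blast
        then have E: "a \<in> edges H" "b \<in> edges H" "a \<noteq> b" using ME ne by auto
        then have "inc H a \<inter> inc H b = {}"
          using M1[OF e] ab by (auto simp: matching_def induced_def)
        then show "inc (induced H' (\<Union>v \<in> inc G e. X' v)) h \<inter>
            inc (induced H' (\<Union>v \<in> inc G e. X' v)) h' = {}"
          using E by (simp add: induced_def H'_simps ab g'g int_eq H.inc_subset)
      qed
      fix h v assume "h \<in> g ` M e" and v: "v \<in> inc G e"
      then obtain a where a: "a \<in> M e" "h = g a" by blast
      then have "a \<in> edges H" using ME by blast
      moreover have "v \<in> verts G" using v G.inc_subset[OF e] by blast
      ultimately show "card (inc H' h \<inter> X' v) = 1"
        using M2[OF e a(1) v] H.inc_subset[of a] XV[of v] a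
        by (simp add: H'_simps g'g X'_def int_eq card_eq le_infI1)
    next
      show "edges H' = (\<Union>e \<in> edges G. g ` M e)"
        by (simp add: H'_simps M3 image_UN)
    qed
  qed
  moreover have "\<forall>v \<in> verts G. card (X' v) \<ge> k"
    using large by (simp add: X'_def card_eq XV)
  ultimately have "cover_colorable G X' H'"
    using k unfolding dp_colorable_def by blast
  then obtain T where T: "independent H' T" "\<forall>v \<in> verts G. card (T \<inter> X' v) = 1"
    unfolding cover_colorable_def by blast
  then have "T \<subseteq> f ` verts H" by (simp add: independent_def H'_simps)
  then obtain S where S: "S \<subseteq> verts H" "T = f ` S" by (meson subset_imageE)
  have "card (S \<inter> X v) = 1" if v: "v \<in> verts G" for v
  proof -
    have "S \<inter> X v \<subseteq> verts H" using S(1) by (rule le_infI1)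
    then have "card (S \<inter> X v) = card (f ` (S \<inter> X v))" by (rule card_eq[symmetric])
    also have "\<dots> = card (T \<inter> X' v)" by (simp only: S(2) X'_def int_eq[OF S(1) XV[OF v]])
    finally show ?thesis using T(2) v by simp
  qed
  then show ?thesis
    using T(1) S ind_iff unfolding cover_colorable_def by blast
qed

end

theory Submission
  imports Defs
begin

text \<open>
  Greedy coloring shows that a cover without coloring whose color classes are at least as large as
  the degrees must have classes exactly as large as the degrees, so a connected hypergraph with
  \<open>\<chi>\<^sub>D\<^sub>P = \<Delta> + 1\<close> is regular. At a cut vertex the color class splits into two parts that witness
  the same obstruction on both sides; on the side away from a chosen root this gives a smaller
  obstructed hypergraph whose degrees are all \<open>\<Delta>\<close> except at the cut vertex, and induction yields
  a contradiction. Without cut vertices, shrinking an edge with at least three vertices shows that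
  it is the only edge. In the remaining case of a 2-connected multigraph, two non-adjacent
  neighbors of a vertex must separate the graph, so by the argument of Lovasz the underlying simple
  graph is complete or a cycle, and equality of the multiplicities follows by coloring everything
  except the ends of one edge.
\<close>

section \<open>Two-connected multigraphs\<close>

text \<open>If color classes are only required to be as large as the degrees, bricks glued at cut
  vertices give further obstructions, such as a path on three vertices with classes of sizes 1, 2,
  1. To shrink edges and pass to sides freely, covers are replaced by abstract conflict predicates;
  on multigraphs only the number of conflicts per color is kept. The engine is tightness: with no
  spare color anywhere, two compatibly colored vertices never exclude the same color of a third one,
  provided the uncolored rest is connected. For the converse, the \<open>t\<close> parallel edges
  jointly realize a complete bipartite graph between blocks of \<open>t\<close> colors, so
  \<open>t\<close> disappears from the problem. What is left is an injection of \<open>n\<close>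
  vertices into \<open>n - 1\<close> blocks for \<open>tK\<close>, and for \<open>tC\<close> a
  labeling by two blocks around a cycle with one contradictory edge. A single edge is its own
  cover.\<close>

locale mgraph =
  fixes m :: "'v \<Rightarrow> 'v \<Rightarrow> nat"
  assumes m_sym: "m u v = m v u" and m_irrefl: "m v v = 0"
begin

text \<open>Connectivity is stated through cuts rather than paths, since most uses feed in a
  specific set \<open>S\<close> and take out a crossing edge. The empty set and singletons qualify
  vacuously.\<close>

definition conn :: "'v set \<Rightarrow> bool" where
  "conn U \<longleftrightarrow> (\<forall>S. S \<subset> U \<and> S \<noteq> {} \<longrightarrow> (\<exists>s\<in>S. \<exists>r\<in>U - S. m s r > 0))"

definition dg :: "'v set \<Rightarrow> 'v \<Rightarrow> nat" where
  "dg U v = (\<Sum>u\<in>U - {v}. m v u)"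

definition nbr :: "'v set \<Rightarrow> 'v \<Rightarrow> 'v set" where
  "nbr U v = {u \<in> U. m v u > 0}"

lemma connD:
  assumes "conn U" "S \<subset> U" "S \<noteq> {}"
  obtains s r where "s \<in> S" "r \<in> U" "r \<notin> S" "m s r > 0"
  using assms unfolding conn_def by blast

lemma conn_insert:
  assumes W: "conn W" and z: "z \<in> W" "m v z > 0"
  shows "conn (insert v W)"
  unfolding conn_def
proof (intro allI impI)
  fix S assume S: "S \<subset> insert v W \<and> S \<noteq> {}"
  show "\<exists>s\<in>S. \<exists>r\<in>insert v W - S. m s r > 0"
  proof (cases "S \<inter> W = {} \<or> W \<subseteq> S")
    case True
    have vz: "m z v > 0" using z m_sym by metis
    from True show ?thesis
    proof
      assume "S \<inter> W = {}"
      then have "v \<in> S" "z \<notin> S" using S z by auto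
      then show ?thesis using z by blast
    next
      assume "W \<subseteq> S"
      then have "v \<notin> S" "z \<in> S" using S z by auto
      then show ?thesis using vz by blast
    qed
  next
    case False
    then have "S \<inter> W \<subset> W" "S \<inter> W \<noteq> {}" by auto
    with W obtain s r where "s \<in> S \<inter> W" "r \<in> W" "r \<notin> S \<inter> W" "m s r > 0"
      by (rule connD)
    then show ?thesis by blast
  qed
qed

lemma nbr_nonempty:
  assumes "conn U" "v \<in> U" "U \<noteq> {v}"
  shows "nbr U v \<noteq> {}"
proof -
  have "{v} \<subset> U" using assms by blast
  with assms(1) obtain s r where "s \<in> {v}" "r \<in> U" "r \<notin> {v}" "m s r > 0"
    by (rule connD) auto
  then show ?thesis by (auto simp: nbr_def)
qed

section \<open>Lovasz's argument: a Brooks triple, a complete graph or a cycle\<close>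

definition two_connected :: "'v set \<Rightarrow> bool" where
  "two_connected U \<longleftrightarrow> finite U \<and> conn U \<and> (\<forall>z\<in>U. conn (U - {z}))"

text \<open>The configuration in Lovasz's proof of Brooks' theorem: giving \<open>u\<close> and
  \<open>w\<close> colors that exclude the same color of \<open>v\<close> would leave
  \<open>v\<close> a spare color.\<close>

definition brooks_triple :: "'v set \<Rightarrow> 'v \<Rightarrow> 'v \<Rightarrow> 'v \<Rightarrow> bool" where
  "brooks_triple U v u w \<longleftrightarrow> u \<in> U \<and> v \<in> U \<and> w \<in> U \<and> u \<noteq> w \<and>
     m v u > 0 \<and> m v w > 0 \<and> m u w = 0 \<and> conn (U - {u, w})"

text \<open>Lobes need not be connected; a minimal one behaves like the interior of an end block.\<close>

definition lobe :: "'v set \<Rightarrow> 'v \<Rightarrow> 'v set \<Rightarrow> bool" where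
  "lobe W c C \<longleftrightarrow> c \<in> W \<and> C \<subseteq> W - {c} \<and> C \<noteq> {} \<and> W - {c} - C \<noteq> {} \<and>
     (\<forall>x\<in>C. \<forall>y\<in>W - {c} - C. m x y = 0)"

lemma not_conn_split:
  assumes "\<not> conn U" "c \<in> U"
  obtains D where "D \<subseteq> U - {c}" "D \<noteq> {}" "\<forall>x\<in>D. \<forall>y\<in>U - D. m x y = 0"
proof -
  obtain S where S: "S \<subset> U" "S \<noteq> {}" "\<forall>x\<in>S. \<forall>y\<in>U - S. m x y = 0"
    using assms unfolding conn_def by auto
  show thesis
  proof (cases "c \<in> S")
    case False
    then show thesis using S that[of S] by blast
  next
    case True
    have "\<forall>x\<in>U - S. \<forall>y\<in>U - (U - S). m x y = 0"
      using S(1,3) m_sym by (metis Diff_Diff_Int Int_iff)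
    then show thesis using S True that[of "U - S"] by blast
  qed
qed

text \<open>Since \<open>c\<close> is not a cut vertex of \<open>U\<close>, some \<open>s\<close> in
  the lobe has a neighbor outside it other than \<open>c\<close>, which can only be
  \<open>v\<close>. If removing \<open>s\<close> disconnects \<open>U - {v}\<close>, then
  \<open>s\<close> cuts off a strictly smaller lobe inside \<open>C\<close>, and induction
  applies.\<close>

lemma lobe_vertex:
  assumes U: "two_connected U" and v: "v \<in> U" and "lobe (U - {v}) c C"
  shows "\<exists>u\<in>C. m v u > 0 \<and> conn (U - {v} - {u})"
  using assms(3)
proof (induction "card C" arbitrary: c C rule: less_induct)
  case less
  let ?W = "U - {v}"
  have L: "c \<in> ?W" "C \<subseteq> ?W - {c}" "C \<noteq> {}" "?W - {c} - C \<noteq> {}"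
    "\<And>x y. x \<in> C \<Longrightarrow> y \<in> ?W - {c} - C \<Longrightarrow> m x y = 0"
    using less.prems unfolding lobe_def by auto
  have Wconn: "conn ?W" and "conn (U - {c})" and fin: "finite U"
    using U v L(1) unfolding two_connected_def by auto
  have "C \<subset> U - {c}" using L(1,2) v by blast
  from \<open>conn (U - {c})\<close> this L(3) obtain s r
    where sr: "s \<in> C" "r \<in> U - {c}" "r \<notin> C" "m s r > 0"
    by (rule connD)
  have "r = v" using L(5)[of s r] sr by auto
  then have us: "m v s > 0" using sr m_sym by metis
  show ?case
  proof (cases "conn (?W - {s})")
    case True
    then show ?thesis using us sr by blast
  next
    case False
    have cs: "c \<in> ?W - {s}" using L sr by auto
    from not_conn_split[OF False cs] obtain D where
      D: "D \<subseteq> ?W - {s} - {c}" "D \<noteq> {}" "\<forall>x\<in>D. \<forall>y\<in>?W - {s} - D. m x y = 0" by blast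
    \<comment> \<open>A part \<open>D\<close> disjoint from \<open>C\<close> would be attached to
      the rest of \<open>U - {v}\<close> only through \<open>s\<close>, but \<open>s\<close> has no
      neighbor there outside \<open>C\<close> other than \<open>c\<close>.\<close>
    have "D \<inter> C \<noteq> {}"
    proof
      assume e: "D \<inter> C = {}"
      have "D \<subset> ?W" using D(1) L(1) by blast
      from Wconn this D(2) obtain a b where ab: "a \<in> D" "b \<in> ?W" "b \<notin> D" "m a b > 0"
        by (rule connD)
      have "b = s"
      proof (rule ccontr)
        assume "b \<noteq> s"
        then have "m a b = 0" using D(3) ab by blast
        then show False using ab(4) by simp
      qed
      then have "m s a > 0" using ab m_sym by metis
      moreover have "a \<in> ?W - {c} - C" using ab(1) D(1) e by blast
      ultimately show False using L(5)[OF sr(1)] by auto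
    qed
    moreover have "m x y = 0" if "x \<in> D \<inter> C" "y \<in> ?W - {s} - (D \<inter> C)" for x y
    proof (cases "y \<in> D")
      case True
      then have "y \<in> ?W - {c} - C" using that D(1) by blast
      then show ?thesis using L(5)[of x y] that by blast
    qed (use that D(3) in blast)
    moreover have "D \<inter> C \<subseteq> ?W - {s}" "s \<in> ?W" "c \<in> ?W - {s} - (D \<inter> C)"
      using D(1) cs sr(1) L(2) by auto
    ultimately have "lobe ?W s (D \<inter> C)"
      unfolding lobe_def by blast
    moreover have "card (D \<inter> C) < card C"
    proof (rule psubset_card_mono)
      show "finite C" using fin L(2) by (meson finite_Diff finite_subset)
      show "D \<inter> C \<subset> C" using sr(1) D(1) by blast
    qed
    ultimately show ?thesis using less.hyps by blast
  qed
qed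

lemma card_ge_3_other:
  assumes "card N \<ge> 3"
  shows "\<exists>z\<in>N. z \<noteq> u \<and> z \<noteq> w"
proof (rule ccontr)
  assume "\<not> ?thesis"
  then have "N \<subseteq> {u, w}" by blast
  then have "card N \<le> card {u, w}" by (intro card_mono) auto
  also have "\<dots> \<le> 2" by (simp add: card_insert_if)
  finally show False using assms by simp
qed

text \<open>The two sides of the cut vertex \<open>c\<close> of \<open>U - {v}\<close> are both
  lobes and supply the non-adjacent neighbors \<open>u\<close> and \<open>w\<close> of
  \<open>v\<close>. Removing both still leaves each side attached to \<open>c\<close>, and a third
  neighbor, available by \<open>n3\<close>, attaches \<open>v\<close> again.\<close>

lemma brooks_triple_at_cut:
  assumes U: "two_connected U" and v: "v \<in> U" and n3: "card (nbr U v) \<ge> 3"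
    and c: "c \<in> U - {v}" and nc: "\<not> conn (U - {v} - {c})"
  shows "\<exists>u w. brooks_triple U v u w"
proof -
  let ?W = "U - {v}"
  obtain C where C: "C \<subset> ?W - {c}" "C \<noteq> {}" "\<forall>x\<in>C. \<forall>y\<in>?W - {c} - C. m x y = 0"
    using nc unfolding conn_def by auto
  define R where "R = ?W - {c} - C"
  have R0: "?W - {c} - R = C" using C(1) by (auto simp: R_def)
  have CR: "m x y = 0" "m y x = 0" if "x \<in> C" "y \<in> R" for x y
    using C(3) that m_sym by (auto simp: R_def)
  have l1: "lobe ?W c C" unfolding lobe_def using C c by blast
  have l2: "lobe ?W c R"
    unfolding lobe_def R0 using C c CR by (auto simp: R_def)
  obtain u where u: "u \<in> C" "m v u > 0" "conn (?W - {u})" using lobe_vertex[OF U v l1] by blast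
  obtain w where w: "w \<in> R" "m v w > 0" "conn (?W - {w})" using lobe_vertex[OF U v l2] by blast
  have cuw: "c \<in> ?W - {u, w}" using u w c C by (auto simp: R_def)
  have "conn (?W - {u, w})"
  proof (rule ccontr)
    assume "\<not> conn (?W - {u, w})"
    from not_conn_split[OF this cuw] obtain D where
      D: "D \<subseteq> ?W - {u, w} - {c}" "D \<noteq> {}" "\<forall>x\<in>D. \<forall>y\<in>?W - {u, w} - D. m x y = 0" .
    \<comment> \<open>If a part \<open>D\<close> separated from \<open>c\<close> meets the side
      \<open>K\<close> of the removed vertex \<open>z\<close>, then \<open>D \<inter> K\<close> is
      already cut off when \<open>z\<close> alone is removed, because the other removed vertex lies
      on the opposite side \<open>Q\<close>.\<close>
    have *: False if Z: "conn (?W - {z})" "z \<notin> D" "D \<inter> K \<noteq> {}" "z \<in> {u, w}"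
      and KQ: "?W - {c} = K \<union> Q" "\<forall>x\<in>K. \<forall>y\<in>Q. m x y = 0" "{u, w} - {z} \<subseteq> Q" for z K Q
    proof -
      have "D \<inter> K \<subseteq> ?W - {z}" "c \<in> ?W - {z}" "c \<notin> D \<inter> K"
        using cuw D(1) Z(2) Z(4) by auto
      then have "D \<inter> K \<subset> ?W - {z}" by blast
      from Z(1) this Z(3) obtain a b
        where ab: "a \<in> D \<inter> K" "b \<in> ?W - {z}" "b \<notin> D \<inter> K" "m a b > 0"
        by (rule connD)
      have "b \<notin> Q" using ab(1,4) KQ(2) by fastforce
      moreover have "b \<in> D \<or> b \<in> {u, w}"
      proof (rule ccontr)
        assume "\<not> ?thesis"
        then have "m a b = 0" using ab(1,2) D(3) by simp
        then show False using ab(4) by simp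
      qed
      ultimately have "b \<in> D" using ab(2) KQ(3) by auto
      then have "b \<in> K" using KQ(1) D(1) \<open>b \<notin> Q\<close> by auto
      then show False using ab(3) \<open>b \<in> D\<close> by simp
    qed
    have split: "?W - {c} = C \<union> R" "?W - {c} = R \<union> C" using C by (auto simp: R_def)
    have CR': "\<forall>x\<in>C. \<forall>y\<in>R. m x y = 0" "\<forall>x\<in>R. \<forall>y\<in>C. m x y = 0" using CR by simp_all
    have uw: "u \<notin> D" "w \<notin> D" "{u, w} - {u} \<subseteq> R" "{u, w} - {w} \<subseteq> C" using u w D(1) by auto
    have "D \<inter> C \<noteq> {} \<or> D \<inter> R \<noteq> {}" using D(1,2) by (auto simp: R_def)
    then show False
      using *[OF u(3) uw(1) _ _ split(1) CR'(1) uw(3)] *[OF w(3) uw(2) _ _ split(2) CR'(2) uw(4)]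
      by (elim disjE) simp_all
  qed
  moreover obtain z where "z \<in> nbr U v" "z \<noteq> u" "z \<noteq> w" using card_ge_3_other[OF n3] by blast
  then have "z \<in> ?W - {u, w}" "m v z > 0" using m_irrefl by (auto simp: nbr_def)
  ultimately have "conn (insert v (?W - {u, w}))" by (intro conn_insert)
  moreover have "v \<noteq> u" "v \<noteq> w" using u w m_irrefl by force+
  then have "insert v (?W - {u, w}) = U - {u, w}" using v by auto
  ultimately have "brooks_triple U v u w"
    unfolding brooks_triple_def using u w C v CR by (auto simp: R_def)
  then show ?thesis by blast
qed

text \<open>By \<open>brooks_triple_at_cut\<close>, deleting a vertex with at least three neighbors
  and any second vertex leaves a connected set. A vertex with at most two neighbors next to such a
  vertex would be isolated by deleting its neighbors, so every vertex has at least three; then the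
  absence of a triple makes adjacency transitive.\<close>

lemma complete_or_degree_le_2:
  assumes U: "two_connected U" and nt: "\<And>v u w. \<not> brooks_triple U v u w"
  shows "(\<forall>u\<in>U. \<forall>v\<in>U. u \<noteq> v \<longrightarrow> m u v > 0) \<or> (\<forall>v\<in>U. card (nbr U v) \<le> 2)"
proof (cases "\<forall>v\<in>U. card (nbr U v) \<le> 2")
  case False
  then obtain v0 where v0: "v0 \<in> U" "card (nbr U v0) \<ge> 3" by force
  have fin: "finite U" and cU: "conn U" using U by (auto simp: two_connected_def)
  have finN: "finite (nbr U v)" for v using fin by (simp add: nbr_def)
  have a: "conn (U - {v} - {c})" if "v \<in> U" "card (nbr U v) \<ge> 3" "c \<in> U - {v}" for v c
    by (rule ccontr) (use brooks_triple_at_cut[OF U that] nt in simp)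
  have b: "card (nbr U s) \<ge> 3" if "s \<in> U" for s
  proof (rule ccontr)
    assume "\<not> card (nbr U s) \<ge> 3"
    then have "{v \<in> U. card (nbr U v) \<ge> 3} \<subset> U" using that by blast
    moreover have "{v \<in> U. card (nbr U v) \<ge> 3} \<noteq> {}" using v0 by blast
    ultimately obtain v s where v: "v \<in> {v \<in> U. card (nbr U v) \<ge> 3}"
      and s: "s \<in> U" "s \<notin> {v \<in> U. card (nbr U v) \<ge> 3}" "m v s > 0"
      by (rule connD[OF cU])
    have vs: "v \<in> nbr U s" "v \<noteq> s" using v s m_sym by (auto simp: nbr_def)
    obtain c0 where c0: "c0 \<in> nbr U v" "c0 \<noteq> s" "c0 \<noteq> v"
      using card_ge_3_other[of "nbr U v"] v by blast
    \<comment> \<open>\<open>c\<close> is the other neighbor of \<open>s\<close> if there is one,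
      and otherwise any further neighbor of \<open>v\<close>.\<close>
    obtain c where c: "c \<in> U - {v}" "nbr U s \<subseteq> {v, c}" "c \<noteq> s"
    proof (cases "nbr U s \<subseteq> {v}")
      case True
      show thesis by (rule that[of c0]) (use True c0 in \<open>auto simp: nbr_def\<close>)
    next
      case False
      then obtain c where c: "c \<in> nbr U s" "c \<noteq> v" by blast
      have "nbr U s \<subseteq> {v, c}"
      proof
        fix z assume "z \<in> nbr U s"
        show "z \<in> {v, c}"
        proof (rule ccontr)
          assume z: "z \<notin> {v, c}"
          have "card {v, c, z} \<le> card (nbr U s)"
            using vs c \<open>z \<in> nbr U s\<close> by (intro card_mono finN) auto
          moreover have "card {v, c, z} = 3" using z c(2) by auto
          ultimately show False using s by simp
        qed
      qed
      moreover have "c \<noteq> s" using c(1) m_irrefl[of s] by (auto simp: nbr_def)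
      moreover have "c \<in> U - {v}" using c by (simp add: nbr_def)
      ultimately show thesis using that by blast
    qed
    have cc: "conn (U - {v} - {c})" using a[of v c] v c(1) by simp
    obtain z where z: "z \<in> nbr U v" "z \<noteq> s" "z \<noteq> c"
      using card_ge_3_other[of "nbr U v"] v by blast
    have "z \<in> U - {v} - {c}" using z m_irrefl[of v] by (auto simp: nbr_def)
    moreover have "s \<in> U - {v} - {c}" using s(1) c(3) vs(2) by simp
    ultimately have "nbr (U - {v} - {c}) s \<noteq> {}"
      using nbr_nonempty[OF cc, of s] z(2) by blast
    then show False using c by (auto simp: nbr_def)
  qed
  have tr: "m u w > 0" if "m v u > 0" "m v w > 0" "u \<noteq> w" "u \<in> U" "v \<in> U" "w \<in> U" for u v w
  proof -
    have "U - {u, w} = U - {u} - {w}" by auto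
    moreover have "conn (U - {u} - {w})" using a[of u w] b[of u] that by simp
    ultimately have "conn (U - {u, w})" by simp
    then show ?thesis using nt[of v u w] that unfolding brooks_triple_def by simp
  qed
  have "m u v > 0" if uv: "u \<in> U" "v \<in> U" "u \<noteq> v" for u v
  proof (rule ccontr)
    assume "\<not> m u v > 0"
    then have "v \<notin> insert u (nbr U u)" using uv by (simp add: nbr_def)
    then have "insert u (nbr U u) \<subset> U" using uv by (auto simp: nbr_def)
    from cU this insert_not_empty obtain s r
      where sr: "s \<in> insert u (nbr U u)" "r \<in> U" "r \<notin> insert u (nbr U u)" "m s r > 0"
      by (rule connD)
    then have "s \<noteq> u" by (auto simp: nbr_def)
    then have s: "s \<in> U" "m s u > 0" using sr(1) m_sym[of s u] by (auto simp: nbr_def)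
    have "m u r > 0" using tr[OF s(2) sr(4)] s sr(2,3) uv(1) by auto
    then show False using sr by (auto simp: nbr_def)
  qed
  then show ?thesis by blast
qed blast

text \<open>A vertex with a single neighbor would be isolated by deleting that neighbor, while a
  third vertex is still present.\<close>

lemma degree_eq_2:
  assumes U: "two_connected U" and "card U \<ge> 3" and v: "v \<in> U" and le: "card (nbr U v) \<le> 2"
  shows "card (nbr U v) = 2"
proof -
  have fin: "finite U" and cU: "conn U" using U by (auto simp: two_connected_def)
  have "U \<noteq> {v}" using assms(2) by auto
  then have "nbr U v \<noteq> {}" using nbr_nonempty[OF cU v] by blast
  then have "card (nbr U v) \<noteq> 0" using fin by (simp add: nbr_def)
  moreover have "card (nbr U v) \<noteq> 1"
  proof
    assume "card (nbr U v) = 1"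
    then obtain c where c: "nbr U v = {c}" by (rule card_1_singletonE)
    then have c': "c \<in> U" "c \<noteq> v" using m_irrefl[of v] by (auto simp: nbr_def)
    then have "conn (U - {c})" using U by (auto simp: two_connected_def)
    moreover obtain z where "z \<in> U" "z \<noteq> c" "z \<noteq> v" using card_ge_3_other[OF assms(2)] by blast
    moreover have "v \<in> U - {c}" using v c' by simp
    ultimately have "nbr (U - {c}) v \<noteq> {}" using nbr_nonempty[of "U - {c}" v] by blast
    then show False using c by (auto simp: nbr_def)
  qed
  ultimately show ?thesis using le by linarith
qed

text \<open>A longest path closes up: the second neighbor of its last vertex lies on the path and,
  since interior vertices have both neighbors beside them, can only be the first vertex. The
  resulting cycle is closed under taking neighbors and hence exhausts \<open>U\<close>.\<close>

lemma cycle_listing: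
  assumes fin: "finite U" and cU: "conn U" and "U \<noteq> {}"
    and deg: "\<And>v. v \<in> U \<Longrightarrow> card (nbr U v) = 2"
  shows "\<exists>n f. n \<ge> 3 \<and> bij_betw f {..<n} U \<and>
    (\<forall>i<n. \<forall>j<n. m (f i) (f j) > 0 \<longleftrightarrow> j = Suc i mod n \<or> i = Suc j mod n)"
proof -
  define path where "path p \<longleftrightarrow> p \<noteq> [] \<and> distinct p \<and> set p \<subseteq> U \<and>
    (\<forall>i. Suc i < length p \<longrightarrow> m (p ! i) (p ! Suc i) > 0)" for p
  have len: "length p < Suc (card U)" if "path p" for p
    using that fin unfolding path_def by (metis card_mono distinct_card less_Suc_eq_le)
  obtain v0 where "v0 \<in> U" using \<open>U \<noteq> {}\<close> by blast
  then have "path [v0]" by (simp add: path_def)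
  then obtain p where p: "path p" "\<And>q. path q \<Longrightarrow> length q \<le> length p"
    using ex_has_greatest_nat[of path "[v0]" length "Suc (card U)"] len by auto
  define n where "n = length p"
  have pp: "p \<noteq> []" "distinct p" "set p \<subseteq> U" and
    adj: "\<And>i. Suc i < n \<Longrightarrow> m (p ! i) (p ! Suc i) > 0" using p(1) by (auto simp: path_def n_def)
  have npos: "n > 0" using pp by (simp add: n_def)
  have inU: "p ! i \<in> U" if "i < n" for i using that pp(3) nth_mem by (auto simp: n_def)
  have inj: "p ! i = p ! j \<longleftrightarrow> i = j" if "i < n" "j < n" for i j
    using that pp(2) by (simp add: n_def nth_eq_iff_index_eq)
  have nb2: "nbr U v = {a, c}" if "v \<in> U" "a \<in> nbr U v" "c \<in> nbr U v" "a \<noteq> c" for v a c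
  proof -
    have "finite (nbr U v)" using fin by (simp add: nbr_def)
    moreover have "{a, c} \<subseteq> nbr U v" "card {a, c} = 2" using that by auto
    ultimately show ?thesis using deg[OF that(1)] by (metis card_subset_eq)
  qed
  have adj': "p ! i \<in> nbr U (p ! Suc i)" "p ! Suc i \<in> nbr U (p ! i)" if "Suc i < n" for i
    using adj[OF that] inU[of i] inU[of "Suc i"] that m_sym by (auto simp: nbr_def)
  have interior: "nbr U (p ! Suc i) = {p ! i, p ! Suc (Suc i)}" if "Suc (Suc i) < n" for i
    using nb2[of "p ! Suc i" "p ! i" "p ! Suc (Suc i)"] adj'(1)[of i] adj'(2)[of "Suc i"] that
      inU[of "Suc i"] inj[of i "Suc (Suc i)"] by auto
  have lastn: "nbr U (p ! (n - 1)) \<subseteq> set p"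
  proof
    fix x assume x: "x \<in> nbr U (p ! (n - 1))"
    show "x \<in> set p"
    proof (rule ccontr)
      assume "x \<notin> set p"
      have "m ((p @ [x]) ! i) ((p @ [x]) ! Suc i) > 0" if "Suc i < length (p @ [x])" for i
      proof (cases "Suc i < n")
        case True then show ?thesis using adj[of i] by (simp add: nth_append n_def)
      next
        case False
        then have "i = n - 1" "Suc i = n" using that npos by (auto simp: n_def)
        then show ?thesis using x by (auto simp: nth_append n_def nbr_def)
      qed
      then have "path (p @ [x])" using \<open>x \<notin> set p\<close> pp x by (auto simp: path_def nbr_def)
      from p(2)[OF this] show False by simp
    qed
  qed
  have "card (set p - {p ! (n - 1)}) \<ge> 2"
  proof -
    have "nbr U (p ! (n - 1)) \<subseteq> set p - {p ! (n - 1)}" using lastn m_irrefl by (auto simp: nbr_def)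
    then have "card (nbr U (p ! (n - 1))) \<le> card (set p - {p ! (n - 1)})" by (intro card_mono) auto
    then show ?thesis using deg[OF inU[of "n - 1"]] npos by simp
  qed
  then have n3: "n \<ge> 3" using npos pp(2) by (simp add: n_def distinct_card)
  define k where "k = n - 3"
  have nk: "n = Suc (Suc (Suc k))" using n3 by (simp add: k_def)
  have fl: "p ! 0 \<in> nbr U (p ! (n - 1))"
  proof -
    have "p ! Suc k \<in> nbr U (p ! (n - 1))" using adj'(1)[of "Suc k"] nk by simp
    moreover have "card (nbr U (p ! (n - 1))) = 2" using deg inU[of "n - 1"] npos by simp
    ultimately obtain y where y: "y \<in> nbr U (p ! (n - 1))" "y \<noteq> p ! Suc k"
      by (metis card_2_iff')
    then obtain j where j: "j < n" "y = p ! j" using lastn by (metis in_set_conv_nth n_def subsetD)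
    have "j \<noteq> n - 1" using y j m_irrefl by (auto simp: nbr_def)
    then have jk: "j < Suc k" using y j nk by (cases "j = Suc k") auto
    have "j = 0"
    proof (rule ccontr)
      assume "j \<noteq> 0"
      then obtain i where i: "j = Suc i" by (cases j) auto
      have "p ! (n - 1) \<in> nbr U (p ! j)" using y j inU[of "n - 1"] npos m_sym by (auto simp: nbr_def)
      then have "p ! (n - 1) = p ! i \<or> p ! (n - 1) = p ! Suc (Suc i)"
        using interior[of i] i jk nk by auto
      then show False using inj[of "n - 1" i] inj[of "n - 1" "Suc (Suc i)"] i jk nk by auto
    qed
    then show ?thesis using y j by simp
  qed
  then have fl': "p ! (n - 1) \<in> nbr U (p ! 0)"
    using inU[of "n - 1"] npos m_sym by (auto simp: nbr_def)
  \<comment> \<open>The predecessor is written \<open>(i + n - 1) mod n\<close> so that subtraction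
    does not truncate at \<open>i = 0\<close>.\<close>
  have nb: "nbr U (p ! i) = {p ! (Suc i mod n), p ! ((i + n - 1) mod n)}" if i: "i < n" for i
  proof -
    consider "i = 0" | "i = n - 1" | k' where "i = Suc k'" "Suc (Suc k') < n"
    proof (cases "i = 0 \<or> i = n - 1")
      case False
      then obtain k' where "i = Suc k'" by (cases i) auto
      then show thesis using False i that(3)[of k'] by linarith
    qed (use that in blast)
    then show ?thesis
    proof cases
      case 1
      have "nbr U (p ! 0) = {p ! Suc 0, p ! (n - 1)}"
        using nb2[OF inU[of 0] adj'(2)[of 0] fl'] inj[of "Suc 0" "n - 1"] nk by simp
      then show ?thesis using 1 nk by simp
    next
      case 2
      have "nbr U (p ! (n - 1)) = {p ! 0, p ! Suc k}"
        using nb2[OF inU[of "n - 1"] fl, of "p ! Suc k"] adj'(1)[of "Suc k"] inj[of 0 "Suc k"] nk by simp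
      moreover have "i + n - 1 = Suc k + n" "Suc i = n" using 2 nk by auto
      then have "(i + n - 1) mod n = Suc k" "Suc i mod n = 0" using nk by (simp_all only: mod_add_self2) auto
      ultimately show ?thesis using 2 by simp
    next
      case 3
      have "i + n - 1 = k' + n" "(k' + n) mod n = k'" "Suc i mod n = Suc i" using 3 by auto
      then show ?thesis using interior[of k'] 3 by auto
    qed
  qed
  have setp: "set p = U"
  proof (rule ccontr)
    assume "set p \<noteq> U"
    then have "set p \<subset> U" "set p \<noteq> {}" using pp by auto
    from cU this obtain s r where sr: "s \<in> set p" "r \<in> U" "r \<notin> set p" "m s r > 0"
      by (rule connD)
    then obtain i where i: "i < n" "s = p ! i" by (metis in_set_conv_nth n_def)
    have "r \<in> nbr U (p ! i)" using sr i by (auto simp: nbr_def)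
    then have "r \<in> {p ! (Suc i mod n), p ! ((i + n - 1) mod n)}" using nb i by simp
    then show False using sr(3) npos by (auto simp: n_def)
  qed
  have "bij_betw ((!) p) {..<n} U"
    unfolding bij_betw_def using setp inj by (auto simp: inj_on_def n_def set_conv_nth)
  moreover have "m (p ! i) (p ! j) > 0 \<longleftrightarrow> j = Suc i mod n \<or> i = Suc j mod n"
    if "i < n" "j < n" for i j
  proof -
    have "m (p ! i) (p ! j) > 0 \<longleftrightarrow> p ! j \<in> nbr U (p ! i)" using inU that by (auto simp: nbr_def)
    also have "\<dots> \<longleftrightarrow> j = Suc i mod n \<or> j = (i + n - 1) mod n"
      using nb that inj[of j "Suc i mod n"] inj[of j "(i + n - 1) mod n"] npos by auto
    also have "j = (i + n - 1) mod n \<longleftrightarrow> i = Suc j mod n"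
    proof (cases i)
      case 0
      then show ?thesis using that by (cases "Suc j = n") auto
    next
      case (Suc i')
      have "(i + n - 1) mod n = i'" using Suc that by simp
      then show ?thesis using Suc that by (cases "Suc j = n") auto
    qed
    finally show ?thesis .
  qed
  ultimately show ?thesis using n3 by (intro exI[of _ n] exI[of _ "(!) p"]) blast
qed

lemma dg_split:
  assumes "finite U" "W \<subseteq> U" "v \<in> W"
  shows "dg U v = dg W v + (\<Sum>s\<in>U - W. m v s)"
proof -
  have "U - {v} = (W - {v}) \<union> (U - W)" using assms by auto
  then show ?thesis
    unfolding dg_def using assms by (simp add: sum.union_disjoint[symmetric] finite_subset Diff_Int_distrib2)
qed

lemma dg_less:
  assumes "finite U" "W \<subseteq> U" "v \<in> W" "r \<in> U" "r \<notin> W" "m v r > 0"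
  shows "dg W v < dg U v"
proof -
  have "m v r \<le> (\<Sum>s\<in>U - W. m v s)" using assms by (intro member_le_sum) auto
  then show ?thesis using dg_split[of U W v] assms by linarith
qed

lemma two_connected_complete:
  assumes "finite U" and pos: "\<And>u v. u \<in> U \<Longrightarrow> v \<in> U \<Longrightarrow> u \<noteq> v \<Longrightarrow> m u v > 0"
  shows "two_connected U"
proof -
  have c: "conn W" if "W \<subseteq> U" for W
    unfolding conn_def
  proof (intro allI impI)
    fix S assume S: "S \<subset> W \<and> S \<noteq> {}"
    then obtain s r where "s \<in> S" "r \<in> W - S" by blast
    moreover then have "m s r > 0" using pos[of s r] S that by blast
    ultimately show "\<exists>s\<in>S. \<exists>r\<in>W - S. m s r > 0" by blast
  qed
  show ?thesis unfolding two_connected_def using assms(1) c by blast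
qed

end

section \<open>Covers of multigraphs\<close>

text \<open>\<open>A u x v y\<close> says that color \<open>x\<close> at \<open>u\<close> excludes
  color \<open>y\<close> at \<open>v\<close>. Parallel edges are merged: of their matchings only the
  total bound \<open>A_card\<close> is kept, which is all that greedy coloring uses.\<close>

locale mcover = mgraph m for m :: "'v \<Rightarrow> 'v \<Rightarrow> nat" +
  fixes A :: "'v \<Rightarrow> 'x \<Rightarrow> 'v \<Rightarrow> 'x \<Rightarrow> bool"
  assumes A_sym: "A u x v y \<longleftrightarrow> A v y u x"
    and A_fin: "finite {y. A u x v y}"
    and A_card: "card {y. A u x v y} \<le> m u v"
begin

definition nb :: "'v \<Rightarrow> 'x \<Rightarrow> 'v \<Rightarrow> 'x set" where
  "nb u x v = {y. A u x v y}"

definition col :: "'v set \<Rightarrow> ('v \<Rightarrow> 'x set) \<Rightarrow> ('v \<Rightarrow> 'x) \<Rightarrow> bool" where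
  "col U X \<phi> \<longleftrightarrow> (\<forall>v\<in>U. \<phi> v \<in> X v) \<and> (\<forall>u\<in>U. \<forall>v\<in>U. \<not> A u (\<phi> u) v (\<phi> v))"

definition obs :: "'v set \<Rightarrow> ('v \<Rightarrow> 'x set) \<Rightarrow> bool" where
  "obs U X \<longleftrightarrow> finite U \<and> U \<noteq> {} \<and> conn U \<and>
     (\<forall>v\<in>U. finite (X v) \<and> dg U v \<le> card (X v)) \<and> (\<nexists>\<phi>. col U X \<phi>)"

lemma A_irrefl: "\<not> A v x v y"
  using A_card[of v x v] A_fin[of v x v] by (auto simp: m_irrefl)

lemma nb_finite: "finite (nb u x v)" and nb_card: "card (nb u x v) \<le> m u v"
  and nb_sym: "y \<in> nb u x v \<longleftrightarrow> x \<in> nb v y u"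
  using A_fin A_card A_sym by (auto simp: nb_def)

lemma col_combine:
  assumes "col S X \<phi>" "col W Y \<psi>" "S \<inter> W = {}"
    and "\<And>v. v \<in> W \<Longrightarrow> Y v = X v - (\<Union>s\<in>S. nb s (\<phi> s) v)"
  shows "col (S \<union> W) X (\<lambda>v. if v \<in> S then \<phi> v else \<psi> v)"
proof -
  let ?\<theta> = "\<lambda>v. if v \<in> S then \<phi> v else \<psi> v"
  have cross: "\<not> A s (\<phi> s) v (\<psi> v)" "\<not> A v (\<psi> v) s (\<phi> s)" if "s \<in> S" "v \<in> W" for s v
  proof -
    have "\<psi> v \<in> Y v" using assms(2) that by (simp add: col_def)
    then show "\<not> A s (\<phi> s) v (\<psi> v)" using that assms(4) by (auto simp: nb_def)
    then show "\<not> A v (\<psi> v) s (\<phi> s)" using A_sym by metis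
  qed
  have "?\<theta> v \<in> X v" if "v \<in> S \<union> W" for v
    using that assms unfolding col_def by auto
  moreover have "\<not> A u (?\<theta> u) v (?\<theta> v)" if "u \<in> S \<union> W" "v \<in> S \<union> W" for u v
    using that assms(1-3) cross unfolding col_def by auto
  ultimately show ?thesis by (simp add: col_def)
qed

text \<open>The hypothesis is a degeneracy condition: a vertex with more colors than its degree in
  \<open>U\<close> is colored last, after the rest by induction.\<close>

lemma greedy:
  assumes "finite U" and "\<And>S. S \<subseteq> U \<Longrightarrow> S \<noteq> {} \<Longrightarrow> \<exists>v\<in>S. dg S v < card (X v)"
  shows "\<exists>\<phi>. col U X \<phi>"
  using assms
proof (induction "card U" arbitrary: U)
  case 0
  then show ?case by (auto simp: col_def)
next
  case (Suc k)
  then have "U \<noteq> {}" by auto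
  then obtain v where v: "v \<in> U" "dg U v < card (X v)" using Suc.prems by blast
  have "\<exists>\<phi>. col (U - {v}) X \<phi>"
  proof (rule Suc.hyps(1))
    show "k = card (U - {v})" "finite (U - {v})" using Suc.hyps(2) Suc.prems(1) v(1) by auto
    show "\<exists>v\<in>S. dg S v < card (X v)" if "S \<subseteq> U - {v}" "S \<noteq> {}" for S
      using Suc.prems(2) that by blast
  qed
  then obtain \<phi> where \<phi>: "col (U - {v}) X \<phi>" by blast
  let ?B = "\<Union>u\<in>U - {v}. nb u (\<phi> u) v"
  have "card ?B \<le> (\<Sum>u\<in>U - {v}. card (nb u (\<phi> u) v))"
    using Suc.prems(1) by (intro card_UN_le) simp
  also have "\<dots> \<le> (\<Sum>u\<in>U - {v}. m u v)" by (intro sum_mono nb_card)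
  also have "\<dots> = dg U v" by (simp add: dg_def m_sym)
  finally have "card ?B < card (X v)" using v by simp
  moreover have "finite ?B" using Suc.prems(1) nb_finite by auto
  ultimately obtain c where c: "c \<in> X v - ?B" by (metis Diff_eq_empty_iff card_mono equals0I leD)
  have "col {v} (\<lambda>v. X v - (\<Union>s\<in>U - {v}. nb s (\<phi> s) v)) (\<lambda>_. c)"
    using c by (auto simp: col_def A_irrefl)
  from col_combine[OF \<phi> this] have "\<exists>\<psi>. col ((U - {v}) \<union> {v}) X \<psi>" by fastforce
  then show ?case using v by (simp add: insert_absorb)
qed

text \<open>A surplus color makes greedy coloring work: on \<open>U\<close> itself through the
  vertex with the surplus, on a proper subset because a crossing edge lowers the degree of one of
  its vertices.\<close>

lemma obs_tight:
  assumes o: "obs U X" and v: "v \<in> U"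
  shows "card (X v) = dg U v"
proof (rule ccontr)
  assume "card (X v) \<noteq> dg U v"
  then have v': "dg U v < card (X v)" using o v by (auto simp: obs_def le_neq_implies_less)
  have fin: "finite U" and cU: "conn U" and le: "\<And>v. v \<in> U \<Longrightarrow> dg U v \<le> card (X v)"
    using o by (auto simp: obs_def)
  have "\<exists>\<phi>. col U X \<phi>"
  proof (rule greedy[OF fin])
    fix S assume S: "S \<subseteq> U" "S \<noteq> {}"
    show "\<exists>v\<in>S. dg S v < card (X v)"
    proof (cases "S = U")
      case False
      then have "S \<subset> U" using S by blast
      from cU this S(2) obtain s r where sr: "s \<in> S" "r \<in> U" "r \<notin> S" "m s r > 0" by (rule connD)
      have "dg S s < card (X s)"
        using dg_less[OF fin S(1) sr] le[of s] sr(1) S(1) by (meson less_le_trans subsetD)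
      then show ?thesis using sr(1) by blast
    qed (use v v' in blast)
  qed
  then show False using o by (simp add: obs_def)
qed

lemma obs_partial_col:
  assumes o: "obs U X" and W: "W \<subset> U"
  shows "\<exists>\<phi>. col W X \<phi>"
proof (rule greedy)
  show "finite W" using o W by (auto simp: obs_def intro: finite_subset)
  fix S assume S: "S \<subseteq> W" "S \<noteq> {}"
  have fin: "finite U" and cU: "conn U" and le: "\<And>v. v \<in> U \<Longrightarrow> dg U v \<le> card (X v)"
    using o by (auto simp: obs_def)
  have S': "S \<subset> U" using S W by blast
  from cU this S(2) obtain s r where sr: "s \<in> S" "r \<in> U" "r \<notin> S" "m s r > 0" by (rule connD)
  have "dg S s < card (X s)"
    using dg_less[OF fin _ sr] le[of s] sr(1) S' by (meson less_le_trans subsetD psubset_imp_subset)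
  then show "\<exists>v\<in>S. dg S v < card (X v)" using sr(1) by blast
qed

abbreviation remaining :: "('v \<Rightarrow> 'x set) \<Rightarrow> 'v set \<Rightarrow> ('v \<Rightarrow> 'x) \<Rightarrow> 'v \<Rightarrow> 'x set" where
  "remaining X S \<phi> v \<equiv> X v - (\<Union>s\<in>S. nb s (\<phi> s) v)"

text \<open>Coloring the vertices outside \<open>W\<close> removes at most as many colors at a
  vertex of \<open>W\<close> as its degree drops, so an obstruction remains. Tightness before and
  after then leaves no room for coinciding exclusions, which is the source of the counting lemmas
  below.\<close>

lemma obs_restrict:
  assumes o: "obs U X" and W: "W \<subseteq> U" "W \<noteq> {}" "conn W" and \<phi>: "col (U - W) X \<phi>"
  shows "obs W (remaining X (U - W) \<phi>)"
    and "v \<in> W \<Longrightarrow> (\<Sum>s\<in>U - W. m v s) \<le> card (X v \<inter> (\<Union>s\<in>U - W. nb s (\<phi> s) v))"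
proof -
  have fin: "finite U" and le: "\<And>v. v \<in> U \<Longrightarrow> dg U v \<le> card (X v)"
    and finX: "\<And>v. v \<in> U \<Longrightarrow> finite (X v)"
    using o by (auto simp: obs_def)
  let ?N = "\<lambda>v. \<Union>s\<in>U - W. nb s (\<phi> s) v"
  have cN: "card (?N v) \<le> (\<Sum>s\<in>U - W. m v s)" for v
  proof -
    have "card (?N v) \<le> (\<Sum>s\<in>U - W. card (nb s (\<phi> s) v))" using fin by (intro card_UN_le) simp
    also have "\<dots> \<le> (\<Sum>s\<in>U - W. m v s)" using nb_card m_sym by (metis (no_types, lifting) sum_mono)
    finally show ?thesis .
  qed
  have finN: "finite (?N v)" for v using fin nb_finite by auto
  show o': "obs W (remaining X (U - W) \<phi>)"
    unfolding obs_def
  proof (intro conjI ballI notI)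
    show "finite W" using fin W finite_subset by blast
    fix v assume v: "v \<in> W"
    then show "finite (remaining X (U - W) \<phi> v)" using finX W by blast
    have "dg U v \<le> card (X v)" using le v W by blast
    moreover have "card (X v) - card (?N v) \<le> card (remaining X (U - W) \<phi> v)"
      using finN by (rule diff_card_le_card_Diff)
    ultimately show "dg W v \<le> card (remaining X (U - W) \<phi> v)"
      using cN[of v] dg_split[OF fin W(1) v] by linarith
  next
    assume "\<exists>\<psi>. col W (remaining X (U - W) \<phi>) \<psi>"
    then obtain \<psi> where \<psi>: "col W (remaining X (U - W) \<phi>) \<psi>" by blast
    have "U - W \<union> W = U" "(U - W) \<inter> W = {}" using W by auto
    then have "\<exists>\<theta>. col U X \<theta>" using col_combine[OF \<phi> \<psi>] by auto
    then show False using o by (simp add: obs_def)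
  qed (use W in auto)
  show "(\<Sum>s\<in>U - W. m v s) \<le> card (X v \<inter> ?N v)" if v: "v \<in> W"
  proof -
    have "card (remaining X (U - W) \<phi> v) = dg W v" using obs_tight[OF o' v] .
    moreover have "card (X v) = dg U v" using obs_tight[OF o] v W by blast
    moreover have "card (X v) = card (X v \<inter> ?N v) + card (X v - ?N v)"
      using finX v W card_Int_Diff by blast
    ultimately show ?thesis using dg_split[OF fin W(1) v] by linarith
  qed
qed

section \<open>Counting excluded colors in a tight obstruction\<close>

lemma card_nb_eq:
  assumes o: "obs U X" and u: "u \<in> U" "conn (U - {u})" and x: "x \<in> X u" and v: "v \<in> U" "v \<noteq> u"
  shows "card (X v \<inter> nb u x v) = m u v"
proof -
  have e: "U - (U - {u}) = {u}" using u by auto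
  have "col {u} X (\<lambda>_. x)" using x by (auto simp: col_def A_irrefl)
  then have "(\<Sum>s\<in>{u}. m v s) \<le> card (X v \<inter> (\<Union>s\<in>{u}. nb s x v))"
    using obs_restrict(2)[OF o, of "U - {u}" "\<lambda>_. x" v] u v unfolding e by blast
  then have le: "m u v \<le> card (X v \<inter> nb u x v)" using m_sym by simp
  moreover have "card (X v \<inter> nb u x v) \<le> card (nb u x v)" by (intro card_mono nb_finite) auto
  ultimately show "card (X v \<inter> nb u x v) = m u v" using nb_card[of u x v] by linarith
qed

text \<open>With \<open>u\<close> and \<open>w\<close> colored compatibly,
  \<open>obs_restrict\<close> demands \<open>m u v + m w v\<close> lost colors at \<open>v\<close>,
  while each of the two excludes at most its own share; an overlap would fall short.\<close>

lemma nb_disjoint: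
  assumes o: "obs U X" and uw: "u \<in> U" "w \<in> U" "u \<noteq> w" and c: "conn (U - {u, w})"
    and xy: "x \<in> X u" "y \<in> X w" "\<not> A u x w y" and v: "v \<in> U - {u, w}"
  shows "X v \<inter> nb u x v \<inter> nb w y v = {}"
proof -
  define \<phi> where "\<phi> = (\<lambda>z. if z = u then x else y)"
  have e: "U - (U - {u, w}) = {u, w}" using uw by auto
  have "\<not> A w y u x" using xy A_sym by blast
  then have "col {u, w} X \<phi>" using xy uw by (auto simp: col_def A_irrefl \<phi>_def)
  then have "(\<Sum>s\<in>{u, w}. m v s) \<le> card (X v \<inter> (\<Union>s\<in>{u, w}. nb s (\<phi> s) v))"
    using obs_restrict(2)[OF o, of "U - {u, w}" \<phi> v] c v unfolding e by blast
  moreover have "(\<Sum>s\<in>{u, w}. m v s) = m u v + m w v" using uw m_sym by simp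
  moreover have "X v \<inter> (\<Union>s\<in>{u, w}. nb s (\<phi> s) v) = (X v \<inter> nb u x v) \<union> (X v \<inter> nb w y v)"
    using uw by (auto simp: \<phi>_def)
  ultimately have "m u v + m w v \<le> card ((X v \<inter> nb u x v) \<union> (X v \<inter> nb w y v))"
    by simp
  moreover have fin: "finite (X v \<inter> nb u x v)" "finite (X v \<inter> nb w y v)" using nb_finite by auto
  moreover have "card (X v \<inter> nb u x v) \<le> m u v" "card (X v \<inter> nb w y v) \<le> m w v"
    using nb_card nb_finite by (meson card_mono inf_le2 order_trans)+
  ultimately have "card ((X v \<inter> nb u x v) \<inter> (X v \<inter> nb w y v)) = 0"
    using card_Un_Int[OF fin] by linarith
  then show ?thesis using fin by auto
qed

text \<open>Any color \<open>z\<close> of \<open>v\<close> is excluded by some color of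
  \<open>u\<close> and by some color of \<open>w\<close>. These are compatible since
  \<open>m u w = 0\<close>, so \<open>z\<close> would be lost twice, against
  \<open>nb_disjoint\<close>.\<close>

lemma no_brooks_triple:
  assumes o: "obs U X" and U: "two_connected U"
  shows "\<not> brooks_triple U v u w"
proof
  assume "brooks_triple U v u w"
  then have t: "u \<in> U" "v \<in> U" "w \<in> U" "u \<noteq> w" "m v u > 0" "m v w > 0" "m u w = 0"
    "conn (U - {u, w})" by (auto simp: brooks_triple_def)
  have ne: "v \<noteq> u" "v \<noteq> w" using t m_irrefl by force+
  have fin: "finite U" using U by (simp add: two_connected_def)
  have "m v u \<le> dg U v" unfolding dg_def using t ne fin by (intro member_le_sum) auto
  then have "card (X v) > 0" using obs_tight[OF o t(2)] t by simp
  then obtain z where z: "z \<in> X v" by (metis card.empty ex_in_conv less_irrefl)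
  have cv: "conn (U - {v})" using U t by (simp add: two_connected_def)
  have "card (X u \<inter> nb v z u) = m v u" "card (X w \<inter> nb v z w) = m v w"
    using card_nb_eq[OF o t(2) cv z] t ne by auto
  then have "X u \<inter> nb v z u \<noteq> {}" "X w \<inter> nb v z w \<noteq> {}" using t by auto
  then obtain x y where xy: "x \<in> X u" "z \<in> nb u x v" "y \<in> X w" "z \<in> nb w y v"
    using nb_sym by blast
  have "\<not> A u x w y"
    using nb_card[of u x w] nb_finite[of u x w] t(7) by (auto simp: nb_def)
  with nb_disjoint[OF o t(1,3,4,8) xy(1,3)] show False using xy z t ne by blast
qed

text \<open>Once everything except \<open>b\<close> and \<open>c\<close> is colored, the remaining colors of \<open>b\<close> and \<open>c\<close> are
completely joined, so a further color of \<open>c\<close> has all its neighbors among the other colors of \<open>b\<close>.\<close>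

lemma double_multiplicity_le:
  assumes o: "obs U X" and b: "b \<in> U" and c: "c \<in> U" "conn (U - {c})"
    and bc: "m b c > 0" "dg U c > m b c"
  shows "2 * m b c \<le> dg U b"
proof -
  have ne: "b \<noteq> c" using bc m_irrefl by force
  have mcb: "m c b = m b c" by (rule m_sym)
  let ?W = "{b, c}"
  have W: "?W \<subseteq> U" "?W \<noteq> {}" using b c by auto
  have dW: "dg ?W b = m b c" "dg ?W c = m b c" using ne mcb by (auto simp: dg_def insert_Diff_if)
  have cW: "conn ?W"
    by (rule conn_insert[where z = c]) (use bc in \<open>auto simp: conn_def\<close>)
  have "?W \<noteq> U"
    using bc dW by auto
  then have "U - ?W \<subset> U" using W by blast
  then obtain \<phi> where \<phi>: "col (U - ?W) X \<phi>" using obs_partial_col[OF o] by blast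
  let ?Q = "remaining X (U - ?W) \<phi>"
  have oW: "obs ?W ?Q" using obs_restrict(1)[OF o W cW \<phi>] .
  have cQ: "card (?Q b) = m b c" "card (?Q c) = m b c" using obs_tight[OF oW] dW by auto
  have finQ: "finite (?Q b)" "finite (?Q c)" using oW by (auto simp: obs_def)
  have adj: "A b y c y'" if "y \<in> ?Q b" "y' \<in> ?Q c" for y y'
  proof (rule ccontr)
    assume n: "\<not> A b y c y'"
    then have "\<not> A c y' b y" using A_sym by blast
    then have "col ?W ?Q (\<lambda>z. if z = b then y else y')"
      using n that ne unfolding col_def by (simp add: A_irrefl)
    then show False using oW by (auto simp: obs_def)
  qed
  have nbQ: "nb b y c = ?Q c" if "y \<in> ?Q b" for y
  proof -
    have "?Q c \<subseteq> nb b y c" using adj[OF that] by (auto simp: nb_def)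
    moreover have "card (nb b y c) \<le> card (?Q c)" unfolding cQ(2) by (rule nb_card)
    ultimately show ?thesis by (rule card_seteq[OF nb_finite, symmetric])
  qed
  \<comment> \<open>Here \<open>dg U c > m b c\<close> enters: \<open>c\<close> has a color that
    does not survive the partial coloring.\<close>
  have "card (X c) > card (?Q c)" using obs_tight[OF o c(1)] bc cQ by simp
  then have "\<not> X c \<subseteq> ?Q c" using card_mono[OF finQ(2)] by (meson leD)
  then obtain z where z: "z \<in> X c" "z \<notin> ?Q c" by blast
  have "nb c z b \<inter> ?Q b = {}"
  proof (rule ccontr)
    assume "nb c z b \<inter> ?Q b \<noteq> {}"
    then obtain y where "y \<in> nb c z b" "y \<in> ?Q b" by blast
    then have "z \<in> nb b y c" using nb_sym[of y c z b] by blast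
    then show False using z(2) unfolding nbQ[OF \<open>y \<in> ?Q b\<close>] by (rule notE[rotated])
  qed
  \<comment> \<open>The \<open>m b c\<close> colors of \<open>b\<close> excluded by \<open>z\<close>
    and the \<open>m b c\<close> surviving ones are disjoint subsets of \<open>X b\<close>, which
    has \<open>dg U b\<close> elements.\<close>
  then have "(X b \<inter> nb c z b) \<inter> ?Q b = {}" by blast
  moreover have finX: "finite (X b)" using o b by (simp add: obs_def)
  ultimately have "card (X b \<inter> nb c z b) + card (?Q b) = card ((X b \<inter> nb c z b) \<union> ?Q b)"
    by (intro card_Un_disjoint[symmetric]) auto
  also have "\<dots> \<le> card (X b)" using finX by (intro card_mono) auto
  finally show ?thesis
    using card_nb_eq[OF o c z(1) b ne] cQ mcb obs_tight[OF o b] by simp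
qed

text \<open>Coloring everything outside a triangle leaves an obstruction on it, where
  \<open>double_multiplicity_le\<close> reads \<open>2 * m b c \<le> m b a + m b c\<close>. Used in
  both directions it makes the two edges at \<open>b\<close> equally thick, and equality at common
  ends spreads to all pairs.\<close>

lemma complete_multiplicities:
  assumes o: "obs U X" and pos: "\<And>u v. u \<in> U \<Longrightarrow> v \<in> U \<Longrightarrow> u \<noteq> v \<Longrightarrow> m u v > 0"
  shows "\<exists>t\<ge>1. \<forall>u\<in>U. \<forall>v\<in>U. u \<noteq> v \<longrightarrow> m u v = t"
proof -
  have le: "m b c \<le> m b a" if "{a, b, c} \<subseteq> U" "a \<noteq> b" "b \<noteq> c" "a \<noteq> c" for a b c
  proof -
    let ?W = "{a, b, c}"
    have tc: "two_connected ?W" by (rule two_connected_complete) (use pos that in blast)+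
    then have cW: "conn ?W" "conn (?W - {c})" by (auto simp: two_connected_def)
    have "U - ?W \<subset> U" using that by blast
    then obtain \<phi> where \<phi>: "col (U - ?W) X \<phi>" using obs_partial_col[OF o] by blast
    have oW: "obs ?W (remaining X (U - ?W) \<phi>)"
      using obs_restrict(1)[OF o that(1) _ cW(1) \<phi>] by blast
    have "?W - {b} = {a, c}" "?W - {c} = {a, b}" using that by auto
    then have d: "dg ?W b = m b a + m b c" "dg ?W c = m c a + m c b"
      using that by (simp_all add: dg_def)
    have "m b c > 0" "m c a > 0" using pos that by auto
    then have "2 * m b c \<le> dg ?W b"
      using double_multiplicity_le[OF oW, of b c] cW(2) d m_sym[of c b] by simp
    then show ?thesis using d by simp
  qed
  have eq: "m b c = m b a" if "{a, b, c} \<subseteq> U" "a \<noteq> b" "b \<noteq> c" for a b c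
    using le[of a b c] le[of c b a] that by (cases "a = c") (auto intro: order_antisym)
  show ?thesis
  proof (cases "\<exists>a\<in>U. \<exists>b\<in>U. a \<noteq> b")
    case True
    then obtain a b where ab: "a \<in> U" "b \<in> U" "a \<noteq> b" by blast
    have "m u v = m a b" if uv: "u \<in> U" "v \<in> U" "u \<noteq> v" for u v
    proof -
      have "m u v = m a b" if "u = a" "v = b \<or> v \<noteq> b"
        using eq[of b a v] that uv ab by auto
      moreover have "m u v = m a b" if "u \<noteq> a"
      proof -
        have "m u v = m u a" using eq[of a u v] that uv ab by auto
        also have "\<dots> = m a u" by (rule m_sym)
        also have "\<dots> = m a b" using eq[of b a u] that uv ab by auto
        finally show ?thesis .
      qed
      ultimately show ?thesis by blast
    qed
    moreover have "m a b \<ge> 1" using pos[OF ab] by simp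
    ultimately show ?thesis by blast
  \<comment> \<open>With fewer than two vertices the condition is vacuous and \<open>1\<close> is an
    arbitrary choice.\<close>
  qed (auto intro: exI[of _ 1])
qed

text \<open>At \<open>v\<close> with neighbors \<open>a\<close> and \<open>c\<close> the degree is
  \<open>m v a + m v c\<close>, so \<open>double_multiplicity_le\<close> on all of \<open>U\<close>
  compares the two; its strictness condition holds because \<open>c\<close> has a second neighbor.
  Connectivity carries the common value around.\<close>

lemma cycle_multiplicities:
  assumes o: "obs U X" and U: "two_connected U" and deg: "\<And>v. v \<in> U \<Longrightarrow> card (nbr U v) = 2"
  shows "\<exists>t\<ge>1. \<forall>u\<in>U. \<forall>v\<in>U. m u v > 0 \<longrightarrow> m u v = t"
proof -
  have fin: "finite U" and cU: "conn U" and c1: "\<And>c. c \<in> U \<Longrightarrow> conn (U - {c})"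
    using U by (auto simp: two_connected_def)
  have dg2: "dg U v = m v a + m v c" if "v \<in> U" "nbr U v = {a, c}" "a \<noteq> c" for v a c
  proof -
    have "v \<notin> nbr U v" "nbr U v \<subseteq> U" using m_irrefl by (auto simp: nbr_def)
    then have "dg U v = (\<Sum>u\<in>nbr U v. m v u)"
      unfolding dg_def using fin by (intro sum.mono_neutral_right) (auto simp: nbr_def)
    then show ?thesis using that by simp
  qed
  have eq: "m v a = m v c" if v: "v \<in> U" and ac: "a \<in> nbr U v" "c \<in> nbr U v" for v a c
  proof -
    have le: "m v c \<le> m v a" if ac: "a \<in> nbr U v" "c \<in> nbr U v" "a \<noteq> c" for a c
    proof -
      have "finite (nbr U v)" using fin by (simp add: nbr_def)
      moreover have "{a, c} \<subseteq> nbr U v" "card {a, c} = card (nbr U v)" using ac deg[OF v] by auto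
      ultimately have nv: "nbr U v = {a, c}" using card_subset_eq by metis
      have c: "c \<in> U" "m v c > 0" using ac by (auto simp: nbr_def)
      then obtain x y where xy: "nbr U c = {x, y}" "x \<noteq> y" using deg[OF c(1)] by (meson card_2_iff)
      have "v \<in> nbr U c" using c v m_sym by (simp add: nbr_def)
      then have "dg U c > m v c"
        using dg2[OF c(1) xy] xy m_sym[of v c] by (auto simp: nbr_def set_eq_iff)
      from double_multiplicity_le[OF o v c(1) c1[OF c(1)] c(2) this] show ?thesis
        using dg2[OF v nv ac(3)] by simp
    qed
    show ?thesis using le[of a c] le[of c a] ac by (cases "a = c") auto
  qed
  obtain v0 where v0: "v0 \<in> U" using o by (auto simp: obs_def)
  then have "nbr U v0 \<noteq> {}" using deg by fastforce
  then obtain u0 where u0: "u0 \<in> nbr U v0" by blast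
  define t where "t = m v0 u0"
  define S where "S = {v \<in> U. \<forall>u\<in>nbr U v. m v u = t}"
  have "S = U"
  proof (rule ccontr)
    assume "S \<noteq> U"
    then have "S \<subset> U" by (auto simp: S_def)
    moreover have "v0 \<in> S" unfolding S_def t_def using v0 eq[OF v0 _ u0] by blast
    then have "S \<noteq> {}" by blast
    ultimately obtain s r where sr: "s \<in> S" "r \<in> U" "r \<notin> S" "m s r > 0" by (rule connD[OF cU])
    have "m s r = t" "s \<in> nbr U r" using sr m_sym[of s r] by (auto simp: S_def nbr_def)
    then have "\<forall>u\<in>nbr U r. m r u = t" using eq[OF sr(2)] m_sym[of s r] by metis
    then show False using sr by (simp add: S_def)
  qed
  then have "\<forall>u\<in>U. \<forall>v\<in>U. m u v > 0 \<longrightarrow> m u v = t" by (auto simp: S_def nbr_def)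
  moreover have "t \<ge> 1" using u0 by (simp add: t_def nbr_def)
  ultimately show ?thesis by blast
qed

text \<open>Regularity is recorded besides the shape because the induction over cut vertices needs
  it to determine the degree of the cut vertex within one side.\<close>

theorem obs_two_connected:
  assumes o: "obs U X" and U: "two_connected U"
  shows "(\<exists>t\<ge>1. \<forall>u\<in>U. \<forall>v\<in>U. u \<noteq> v \<longrightarrow> m u v = t) \<or>
    (\<exists>t\<ge>1. \<exists>n\<ge>3. \<exists>f. bij_betw f {..<n} U \<and>
      (\<forall>i<n. \<forall>j<n. m (f i) (f j) = (if j = Suc i mod n \<or> i = Suc j mod n then t else 0)))"
    (is "?K \<or> ?C")
    and "\<exists>d. \<forall>v\<in>U. dg U v = d"
proof -
  have fin: "finite U" and cU: "conn U" using U by (auto simp: two_connected_def)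
  have "(?K \<or> ?C) \<and> (\<exists>d. \<forall>v\<in>U. dg U v = d)"
  proof (cases "\<forall>u\<in>U. \<forall>v\<in>U. u \<noteq> v \<longrightarrow> m u v > 0")
    case True
    then obtain t where t: "t \<ge> 1" "\<forall>u\<in>U. \<forall>v\<in>U. u \<noteq> v \<longrightarrow> m u v = t"
      using complete_multiplicities[OF o] by blast
    have "dg U v = t * (card U - 1)" if "v \<in> U" for v
    proof -
      have "dg U v = (\<Sum>u\<in>U - {v}. t)" unfolding dg_def using t that by (intro sum.cong) auto
      then show ?thesis using that by simp
    qed
    then show ?thesis using t by blast
  next
    case False
    then obtain u v where uv: "u \<in> U" "v \<in> U" "u \<noteq> v" "m u v = 0" by auto
    have le2: "card (nbr U v) \<le> 2" if "v \<in> U" for v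
      using complete_or_degree_le_2[OF U no_brooks_triple[OF o U]] False that by blast
    have "nbr U u \<noteq> {}" using nbr_nonempty[OF cU uv(1)] uv by blast
    then obtain z where "z \<in> nbr U u" by blast
    then have "z \<in> U" "z \<noteq> u" "z \<noteq> v" using uv m_irrefl[of u] by (auto simp: nbr_def)
    then have "card {u, v, z} = 3" "{u, v, z} \<subseteq> U" using uv by auto
    then have U3: "card U \<ge> 3" using card_mono[OF fin] by metis
    have deg: "card (nbr U v) = 2" if "v \<in> U" for v using degree_eq_2[OF U U3 that le2[OF that]] .
    obtain t where t: "t \<ge> 1" "\<forall>u\<in>U. \<forall>v\<in>U. m u v > 0 \<longrightarrow> m u v = t"
      using cycle_multiplicities[OF o U deg] by blast
    obtain n f where f: "n \<ge> 3" "bij_betw f {..<n} U"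
      "\<forall>i<n. \<forall>j<n. m (f i) (f j) > 0 \<longleftrightarrow> j = Suc i mod n \<or> i = Suc j mod n"
      using cycle_listing[OF fin cU _ deg] uv by blast
    have "m (f i) (f j) = (if j = Suc i mod n \<or> i = Suc j mod n then t else 0)" if "i < n" "j < n" for i j
    proof -
      have "f i \<in> U" "f j \<in> U" using f(2) that by (auto simp: bij_betw_def)
      then show ?thesis using f(3) t(2) that by (metis gr0I)
    qed
    then have ?C using t f by blast
    moreover have "dg U v = t * 2" if "v \<in> U" for v
    proof -
      have "v \<notin> nbr U v" using m_irrefl by (simp add: nbr_def)
      then have "dg U v = (\<Sum>u\<in>nbr U v. m v u)"
        unfolding dg_def using fin by (intro sum.mono_neutral_right) (auto simp: nbr_def)
      also have "\<dots> = (\<Sum>u\<in>nbr U v. t)" using t that by (intro sum.cong) (auto simp: nbr_def)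
      finally show ?thesis using deg[OF that] by simp
    qed
    ultimately show ?thesis by blast
  qed
  then show "?K \<or> ?C" "\<exists>d. \<forall>v\<in>U. dg U v = d" by auto
qed

end

section \<open>Hypergraphs with conflicts\<close>

locale hsys =
  fixes E :: "'e set" and I :: "'e \<Rightarrow> 'v set"
  assumes finite_E: "finite E"
    and finite_I: "e \<in> E \<Longrightarrow> finite (I e)"
    and card_I: "e \<in> E \<Longrightarrow> card (I e) \<ge> 2"
begin

text \<open>Edges not contained in \<open>U\<close> are dropped, never shortened; shrinking an edge
  is done by changing \<open>I\<close> itself.\<close>

definition hdg :: "'v set \<Rightarrow> 'v \<Rightarrow> nat" where
  "hdg U v = card {e \<in> E. v \<in> I e \<and> I e \<subseteq> U}"

definition hconn :: "'v set \<Rightarrow> bool" where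
  "hconn U \<longleftrightarrow> (\<forall>S. S \<subset> U \<and> S \<noteq> {} \<longrightarrow> (\<exists>e\<in>E. I e \<subseteq> U \<and> I e \<inter> S \<noteq> {} \<and> \<not> I e \<subseteq> S))"

text \<open>This abstracts the matchings of a cover: a conflict depends only on the colors on its
  edge, and disjointness of matching edges becomes uniqueness of a conflict through a given color.
  In this form an edge is shrunk by changing only \<open>I\<close> and \<open>conf\<close> at
  it.\<close>

definition conflict_system :: "('e \<Rightarrow> ('v \<Rightarrow> 'x) \<Rightarrow> bool) \<Rightarrow> bool" where
  "conflict_system conf \<longleftrightarrow>
     (\<forall>e\<in>E. \<forall>\<phi> \<psi>. conf e \<phi> \<longrightarrow> (\<forall>v\<in>I e. \<phi> v = \<psi> v) \<longrightarrow> conf e \<psi>) \<and>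
     (\<forall>e\<in>E. \<forall>\<phi> \<psi>. \<forall>u\<in>I e. conf e \<phi> \<longrightarrow> conf e \<psi> \<longrightarrow> \<phi> u = \<psi> u \<longrightarrow> (\<forall>v\<in>I e. \<phi> v = \<psi> v))"

definition hcol :: "('e \<Rightarrow> ('v \<Rightarrow> 'x) \<Rightarrow> bool) \<Rightarrow> 'v set \<Rightarrow> ('v \<Rightarrow> 'x set) \<Rightarrow> ('v \<Rightarrow> 'x) \<Rightarrow> bool" where
  "hcol conf U X \<phi> \<longleftrightarrow> (\<forall>v\<in>U. \<phi> v \<in> X v) \<and> (\<forall>e\<in>E. I e \<subseteq> U \<longrightarrow> \<not> conf e \<phi>)"

definition hobs :: "('e \<Rightarrow> ('v \<Rightarrow> 'x) \<Rightarrow> bool) \<Rightarrow> 'v set \<Rightarrow> ('v \<Rightarrow> 'x set) \<Rightarrow> bool" where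
  "hobs conf U X \<longleftrightarrow> finite U \<and> U \<noteq> {} \<and> hconn U \<and> conflict_system conf \<and>
     (\<forall>v\<in>U. finite (X v) \<and> hdg U v \<le> card (X v)) \<and> (\<nexists>\<phi>. hcol conf U X \<phi>)"

definition hcut :: "'v set \<Rightarrow> 'v \<Rightarrow> 'v set \<Rightarrow> 'v set \<Rightarrow> bool" where
  "hcut U w U1 U2 \<longleftrightarrow> U1 \<union> U2 = U \<and> U1 \<inter> U2 = {w} \<and> U1 \<noteq> {w} \<and> U2 \<noteq> {w} \<and>
     (\<forall>e\<in>E. I e \<subseteq> U \<longrightarrow> I e \<subseteq> U1 \<or> I e \<subseteq> U2)"

definition mult :: "'v \<Rightarrow> 'v \<Rightarrow> nat" where
  "mult u v = card {e \<in> E. I e = {u, v}}"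

text \<open>A single vertex falls under the second alternative, with any multiplicity.\<close>

definition brick :: "'v set \<Rightarrow> bool" where
  "brick U \<longleftrightarrow>
     (\<exists>e. {e \<in> E. I e \<subseteq> U} = {e} \<and> I e = U) \<or>
     (\<forall>e\<in>E. I e \<subseteq> U \<longrightarrow> card (I e) = 2) \<and>
       ((\<exists>t\<ge>1. \<forall>u\<in>U. \<forall>v\<in>U. u \<noteq> v \<longrightarrow> mult u v = t) \<or>
        (\<exists>t\<ge>1. \<exists>n\<ge>3. \<exists>f. bij_betw f {..<n} U \<and>
           (\<forall>i<n. \<forall>j<n. mult (f i) (f j) = (if j = Suc i mod n \<or> i = Suc j mod n then t else 0))))"

lemma hconnD:
  assumes "hconn U" "S \<subset> U" "S \<noteq> {}"
  obtains e s where "e \<in> E" "I e \<subseteq> U" "s \<in> I e" "s \<in> S" "\<not> I e \<subseteq> S"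
proof -
  obtain e where "e \<in> E" "I e \<subseteq> U" "I e \<inter> S \<noteq> {}" "\<not> I e \<subseteq> S"
    using assms unfolding hconn_def by meson
  then show thesis using that by (metis disjoint_iff)
qed

lemma conflict_cong:
  "conflict_system conf \<Longrightarrow> e \<in> E \<Longrightarrow> conf e \<phi> \<Longrightarrow> (\<And>v. v \<in> I e \<Longrightarrow> \<phi> v = \<psi> v) \<Longrightarrow> conf e \<psi>"
  unfolding conflict_system_def by blast

lemma conflict_unique:
  "conflict_system conf \<Longrightarrow> e \<in> E \<Longrightarrow> conf e \<phi> \<Longrightarrow> conf e \<psi> \<Longrightarrow> u \<in> I e \<Longrightarrow> \<phi> u = \<psi> u \<Longrightarrow>
    v \<in> I e \<Longrightarrow> \<phi> v = \<psi> v"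
  unfolding conflict_system_def by blast

lemma hcol_cong:
  assumes "conflict_system conf" "hcol conf U X \<phi>" "\<And>v. v \<in> U \<Longrightarrow> \<phi> v = \<psi> v"
  shows "hcol conf U X \<psi>"
proof -
  have "\<not> conf e \<psi>" if e: "e \<in> E" "I e \<subseteq> U" for e
  proof
    assume "conf e \<psi>"
    then have "conf e \<phi>" by (rule conflict_cong[OF assms(1) e(1)]) (use assms(3) e in auto)
    then show False using assms(2) e by (auto simp: hcol_def)
  qed
  then show ?thesis using assms(2,3) by (simp add: hcol_def)
qed

lemma other_vertex:
  assumes "e \<in> E"
  obtains u where "u \<in> I e" "u \<noteq> v"
proof -
  have "\<not> I e \<subseteq> {v}"
    using card_mono[of "{v}" "I e"] card_I[OF assms] by auto
  then show thesis using that by blast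
qed

text \<open>Another vertex of \<open>e\<close> has its color fixed, and by uniqueness this color
  determines the only conflicting one at \<open>v\<close>.\<close>

lemma card_blocked:
  assumes "conflict_system conf" "e \<in> E" "v \<in> I e"
  shows "finite {c. conf e (\<phi>(v := c))}" "card {c. conf e (\<phi>(v := c))} \<le> 1"
proof -
  obtain u where u: "u \<in> I e" "u \<noteq> v" using other_vertex[OF assms(2)] by blast
  have "c = d" if "conf e (\<phi>(v := c))" "conf e (\<phi>(v := d))" for c d
    using conflict_unique[OF assms(1), OF assms(2) that u(1) _ assms(3)] u(2) by simp
  note eq = this
  obtain c where c: "{c. conf e (\<phi>(v := c))} \<subseteq> {c}"
  proof (cases "\<exists>d. conf e (\<phi>(v := d))")
    case True
    then obtain d where d: "conf e (\<phi>(v := d))" ..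
    have "{c. conf e (\<phi>(v := c))} \<subseteq> {d}"
      unfolding subset_iff using eq[OF _ d] by simp
    then show thesis by (rule that)
  next
    case False
    then have "{c. conf e (\<phi>(v := c))} = {}" by simp
    then show thesis using that by simp
  qed
  then show "finite {c. conf e (\<phi>(v := c))}" by (rule finite_subset) simp
  show "card {c. conf e (\<phi>(v := c))} \<le> 1" using card_mono[OF _ c] by simp
qed

lemma hgreedy:
  assumes "finite U" and cs: "conflict_system conf"
    and "\<And>S. S \<subseteq> U \<Longrightarrow> S \<noteq> {} \<Longrightarrow> \<exists>v\<in>S. hdg S v < card (X v)"
  shows "\<exists>\<phi>. hcol conf U X \<phi>"
  using assms(1,3)
proof (induction "card U" arbitrary: U)
  case 0
  have "\<not> I e \<subseteq> {}" if "e \<in> E" for e using card_I[OF that] by auto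
  then show ?case using 0 by (auto simp: hcol_def)
next
  case (Suc k)
  then have "U \<noteq> {}" by auto
  then obtain v where v: "v \<in> U" "hdg U v < card (X v)" using Suc.prems by blast
  have "\<exists>\<phi>. hcol conf (U - {v}) X \<phi>"
  proof (rule Suc.hyps(1))
    show "k = card (U - {v})" "finite (U - {v})" using Suc.hyps(2) Suc.prems(1) v(1) by auto
    show "\<exists>v\<in>S. hdg S v < card (X v)" if "S \<subseteq> U - {v}" "S \<noteq> {}" for S
      using Suc.prems(2) that by blast
  qed
  then obtain \<phi> where \<phi>: "hcol conf (U - {v}) X \<phi>" by blast
  let ?D = "{e \<in> E. v \<in> I e \<and> I e \<subseteq> U}"
  let ?B = "\<Union>e\<in>?D. {c. conf e (\<phi>(v := c))}"
  have "card ?B \<le> (\<Sum>e\<in>?D. card {c. conf e (\<phi>(v := c))})"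
    using finite_E by (intro card_UN_le) simp
  also have "\<dots> \<le> (\<Sum>e\<in>?D. 1)" by (intro sum_mono card_blocked(2)[OF cs]) auto
  also have "\<dots> = hdg U v" by (simp add: hdg_def)
  finally have "card ?B < card (X v)" using v by simp
  moreover have finB: "finite ?B"
    using finite_E card_blocked(1)[OF cs] by (intro finite_UN_I) auto
  ultimately have "\<not> X v \<subseteq> ?B" using card_mono[OF finB, of "X v"] by linarith
  then obtain c where c: "c \<in> X v" "c \<notin> ?B" unfolding subset_iff by auto
  have "hcol conf U X (\<phi>(v := c))"
    unfolding hcol_def
  proof (intro conjI ballI impI)
    fix u assume "u \<in> U"
    then show "(\<phi>(v := c)) u \<in> X u" using \<phi> c(1) by (auto simp: hcol_def)
  next
    fix e assume e: "e \<in> E" "I e \<subseteq> U"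
    show "\<not> conf e (\<phi>(v := c))"
    proof (cases "v \<in> I e")
      case True
      then show ?thesis using c(2) e by blast
    next
      case False
      then have n: "\<not> conf e \<phi>" using \<phi> e unfolding hcol_def by blast
      show ?thesis
      proof
        assume "conf e (\<phi>(v := c))"
        then have "conf e \<phi>" by (rule conflict_cong[OF cs e(1)]) (use False in auto)
        then show False using n by contradiction
      qed
    qed
  qed
  then show ?case by blast
qed

lemma hdg_mono_strict:
  assumes "W \<subseteq> U" "e \<in> E" "I e \<subseteq> U" "v \<in> I e" "\<not> I e \<subseteq> W"
  shows "hdg W v < hdg U v"
  unfolding hdg_def by (intro psubset_card_mono) (use finite_E assms in auto)

lemma hobs_tight:
  assumes o: "hobs conf U X" and v: "v \<in> U"
  shows "card (X v) = hdg U v"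
proof (rule ccontr)
  assume "card (X v) \<noteq> hdg U v"
  then have v': "hdg U v < card (X v)" using o v by (auto simp: hobs_def le_neq_implies_less)
  have fin: "finite U" and cU: "hconn U" and cs: "conflict_system conf"
    and le: "\<And>v. v \<in> U \<Longrightarrow> hdg U v \<le> card (X v)"
    using o by (auto simp: hobs_def)
  have "\<exists>\<phi>. hcol conf U X \<phi>"
  proof (rule hgreedy[OF fin cs])
    fix S assume S: "S \<subseteq> U" "S \<noteq> {}"
    show "\<exists>v\<in>S. hdg S v < card (X v)"
    proof (cases "S = U")
      case False
      then have "S \<subset> U" using S by blast
      from cU this S(2) obtain e s where es: "e \<in> E" "I e \<subseteq> U" "s \<in> I e" "s \<in> S" "\<not> I e \<subseteq> S"
        by (rule hconnD)
      have "hdg S s < card (X s)"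
        using hdg_mono_strict[OF S(1) es(1,2,3,5)] le[of s] es(4) S(1) by (meson less_le_trans subsetD)
      then show ?thesis using es(4) by blast
    qed (use v v' in blast)
  qed
  then show False using o by (simp add: hobs_def)
qed

section \<open>Cut vertices\<close>

text \<open>If \<open>S\<close> avoids \<open>w\<close>, an edge leaving \<open>S\<close> in
  \<open>U\<close> contains a vertex outside \<open>U2\<close> and so stays in \<open>U1\<close>; if
  \<open>S\<close> contains \<open>w\<close>, an edge leaving \<open>S \<union> U2\<close> does the
  same job.\<close>

lemma hcut_hconn:
  assumes cU: "hconn U" and cut: "hcut U w U1 U2"
  shows "hconn U1"
  unfolding hconn_def
proof (intro allI impI)
  have c: "U1 \<union> U2 = U" "U1 \<inter> U2 = {w}" "\<And>e. e \<in> E \<Longrightarrow> I e \<subseteq> U \<Longrightarrow> I e \<subseteq> U1 \<or> I e \<subseteq> U2"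
    using cut by (auto simp: hcut_def)
  fix S assume S: "S \<subset> U1 \<and> S \<noteq> {}"
  show "\<exists>e\<in>E. I e \<subseteq> U1 \<and> I e \<inter> S \<noteq> {} \<and> \<not> I e \<subseteq> S"
  proof (cases "w \<in> S")
    case False
    have "S \<subset> U" "S \<noteq> {}" using S c by auto
    from cU this obtain e s where es: "e \<in> E" "I e \<subseteq> U" "s \<in> I e" "s \<in> S" "\<not> I e \<subseteq> S"
      by (rule hconnD)
    have "s \<notin> U2" using S es(4) False c(2) by auto
    then have "I e \<subseteq> U1" using c(3)[OF es(1,2)] es(3) by blast
    then show ?thesis using es by blast
  next
    case True
    obtain r where r: "r \<in> U1" "r \<notin> S" using S by blast
    then have "r \<notin> S \<union> U2" using c(2) True by auto
    moreover have "r \<in> U" "S \<union> U2 \<subseteq> U" using r S c(1) by auto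
    ultimately have "S \<union> U2 \<subset> U" "S \<union> U2 \<noteq> {}" using S by auto
    from cU this obtain e s where es: "e \<in> E" "I e \<subseteq> U" "s \<in> I e" "s \<in> S \<union> U2" "\<not> I e \<subseteq> S \<union> U2"
      by (rule hconnD)
    have e1: "I e \<subseteq> U1" using c(3)[OF es(1,2)] es(5) by blast
    have "s \<in> S"
    proof (rule ccontr)
      assume "s \<notin> S"
      then have "s \<in> U1 \<inter> U2" using e1 es(3,4) by blast
      then show False using c(2) True \<open>s \<notin> S\<close> by simp
    qed
    then show ?thesis using e1 es by blast
  qed
qed

lemma hcut_sym: "hcut U w U1 U2 \<longleftrightarrow> hcut U w U2 U1"
  unfolding hcut_def by (auto simp: Un_commute Int_commute)

lemma hdg_hcut_other:
  assumes cut: "hcut U w U1 U2" and v: "v \<in> U1" "v \<noteq> w"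
  shows "hdg U1 v = hdg U v"
proof -
  have "v \<notin> U2" using cut v unfolding hcut_def by blast
  then have "{e \<in> E. v \<in> I e \<and> I e \<subseteq> U1} = {e \<in> E. v \<in> I e \<and> I e \<subseteq> U}"
    using cut unfolding hcut_def by blast
  then show ?thesis by (simp add: hdg_def)
qed

text \<open>No edge is counted twice, since an edge inside both sides would be contained in
  \<open>{w}\<close>.\<close>

lemma hdg_hcut_sum:
  assumes cut: "hcut U w U1 U2"
  shows "hdg U w = hdg U1 w + hdg U2 w"
proof -
  let ?D = "\<lambda>U. {e \<in> E. w \<in> I e \<and> I e \<subseteq> U}"
  have "?D U = ?D U1 \<union> ?D U2" using cut unfolding hcut_def by blast
  moreover have "?D U1 \<inter> ?D U2 = {}"
  proof (rule ccontr)
    assume "?D U1 \<inter> ?D U2 \<noteq> {}"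
    then obtain e where "e \<in> E" "I e \<subseteq> U1 \<inter> U2" by blast
    moreover then obtain u where "u \<in> I e" "u \<noteq> w" using other_vertex by blast
    ultimately show False using cut unfolding hcut_def by blast
  qed
  ultimately show ?thesis
    unfolding hdg_def using finite_E by (simp add: card_Un_disjoint)
qed

text \<open>The colors of the cut vertex split into those that cannot be extended to one side and
those that cannot be extended to the other side.\<close>

lemma hobs_hcut:
  assumes o: "hobs conf U X" and cut: "hcut U w U1 U2"
  shows "\<exists>A. hobs conf U1 (X(w := A))"
proof -
  have fin: "finite U" and cU: "hconn U" and cs: "conflict_system conf"
    and le: "\<And>v. v \<in> U \<Longrightarrow> hdg U v \<le> card (X v)" and finX: "\<And>v. v \<in> U \<Longrightarrow> finite (X v)"
    and unc: "\<And>\<phi>. \<not> hcol conf U X \<phi>"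
    using o by (auto simp: hobs_def)
  define A where "A V = {c \<in> X w. \<nexists>\<phi>. hcol conf V X \<phi> \<and> \<phi> w = c}" for V
  have w: "w \<in> U" using cut by (auto simp: hcut_def)
  have finA: "finite (A V)" for V using finX[OF w] by (simp add: A_def)
  have side: "hobs conf V (X(w := A V))" if c: "hcut U w V W" "hdg V w \<le> card (A V)" for V W
    unfolding hobs_def
  proof (intro conjI ballI notI)
    have V: "V \<subseteq> U" "w \<in> V" using c by (auto simp: hcut_def)
    show "finite V" using fin V finite_subset by blast
    show "V = {} \<Longrightarrow> False" using V by blast
    show "hconn V" using hcut_hconn[OF cU c(1)] .
    show "conflict_system conf" by (rule cs)
    fix v assume v: "v \<in> V"
    show "finite ((X(w := A V)) v)" using finA finX v V by auto
    show "hdg V v \<le> card ((X(w := A V)) v)"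
      using c(2) hdg_hcut_other[OF c(1) v] le[of v] v V by auto
  next
    assume "\<exists>\<phi>. hcol conf V (X(w := A V)) \<phi>"
    then obtain \<phi> where \<phi>: "hcol conf V (X(w := A V)) \<phi>" by blast
    have "w \<in> V" using c by (auto simp: hcut_def)
    then have "\<phi> w \<in> A V" using \<phi> by (auto simp: hcol_def)
    moreover have "hcol conf V X \<phi>" using \<phi> \<open>\<phi> w \<in> A V\<close> unfolding hcol_def A_def
      by (auto split: if_splits)
    ultimately show False by (auto simp: A_def)
  qed
  \<comment> \<open>More than \<open>hdg V w\<close> such colors would give an obstruction on
    \<open>V\<close> with a surplus at \<open>w\<close>, against tightness.\<close>
  have upper: "card (A V) \<le> hdg V w" if c: "hcut U w V W" for V W
  proof (rule ccontr)
    assume n: "\<not> card (A V) \<le> hdg V w"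
    then have "hobs conf V (X(w := A V))" using side[OF c] by linarith
    moreover have "w \<in> V" using c by (auto simp: hcut_def)
    ultimately have "card ((X(w := A V)) w) = hdg V w" by (rule hobs_tight)
    then show False using n by simp
  qed
  \<comment> \<open>A color outside both sets extends to each side, and the two colorings agree at
    \<open>w\<close>, so they glue.\<close>
  have "X w \<subseteq> A U1 \<union> A U2"
  proof (rule ccontr)
    assume "\<not> X w \<subseteq> A U1 \<union> A U2"
    then obtain c where c0: "c \<in> X w" "c \<notin> A U1" "c \<notin> A U2" unfolding subset_iff by auto
    then obtain \<phi> \<psi> where c: "hcol conf U1 X \<phi>" "\<phi> w = c" "hcol conf U2 X \<psi>" "\<psi> w = c"
      unfolding A_def by blast
    let ?\<theta> = "\<lambda>v. if v \<in> U1 then \<phi> v else \<psi> v"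
    have 1: "hcol conf U1 X ?\<theta>" by (rule hcol_cong[OF cs c(1)]) simp
    have 2: "hcol conf U2 X ?\<theta>"
    proof (rule hcol_cong[OF cs c(3)])
      fix v assume "v \<in> U2"
      then have "v \<in> U1 \<Longrightarrow> v = w" using cut by (auto simp: hcut_def)
      then show "\<psi> v = ?\<theta> v" using c by auto
    qed
    have "hcol conf U X ?\<theta>"
      unfolding hcol_def
    proof (intro conjI ballI impI)
      fix v assume "v \<in> U"
      then have "v \<in> U1 \<or> v \<in> U2" using cut by (auto simp: hcut_def)
      then show "?\<theta> v \<in> X v" using 1 2 unfolding hcol_def by blast
    next
      fix e assume e: "e \<in> E" "I e \<subseteq> U"
      then have "I e \<subseteq> U1 \<or> I e \<subseteq> U2" using cut by (auto simp: hcut_def)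
      then show "\<not> conf e ?\<theta>" using 1 2 e(1) unfolding hcol_def by blast
    qed
    then show False using unc by blast
  qed
  then have "card (X w) \<le> card (A U1 \<union> A U2)" using finA by (intro card_mono) auto
  also have "\<dots> \<le> card (A U1) + card (A U2)" by (rule card_Un_le)
  finally have "hdg U1 w \<le> card (A U1)"
    using le[OF w] hdg_hcut_sum[OF cut] upper[of U2 U1] cut hcut_sym by auto
  then show ?thesis using side[OF cut] by blast
qed

text \<open>Removing one vertex \<open>v\<close> from a large edge \<open>e\<close> leaves a surplus color at \<open>v\<close>; it must be
useless, so the shrunken hypergraph is disconnected.\<close>

lemma large_edge_separates:
  assumes o: "hobs conf U X" and e: "e \<in> E" "I e \<subseteq> U" "card (I e) \<ge> 3" and v: "v \<in> I e"
  shows "\<exists>S\<subseteq>U. v \<notin> S \<and> I e - {v} \<subseteq> S \<and>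
    (\<forall>e'\<in>E. e' \<noteq> e \<longrightarrow> I e' \<subseteq> U \<longrightarrow> I e' \<inter> S \<noteq> {} \<longrightarrow> I e' \<subseteq> S)"
proof -
  have fin: "finite U" and cU: "hconn U" and cs: "conflict_system conf"
    and le: "\<And>v. v \<in> U \<Longrightarrow> hdg U v \<le> card (X v)"
    and unc: "\<And>\<phi>. \<not> hcol conf U X \<phi>"
    using o by (auto simp: hobs_def)
  let ?I = "I(e := I e - {v})"
  \<comment> \<open>The shrunken edge conflicts as soon as some color of \<open>v\<close> would
    complete a conflict on \<open>e\<close>; avoiding it is safe whatever \<open>v\<close>
    receives.\<close>
  let ?c = "conf(e := \<lambda>\<phi>. \<exists>c. conf e (\<phi>(v := c)))"
  interpret s: hsys E ?I
  proof
    show "finite E" by (rule finite_E)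
    fix e' assume "e' \<in> E"
    then show "finite (?I e')" "2 \<le> card (?I e')"
      using finite_I card_I e v by auto
  qed
  have scs: "s.conflict_system ?c"
    unfolding s.conflict_system_def
  proof (intro conjI ballI allI impI)
    fix e' \<phi> \<psi> assume e': "e' \<in> E" and c: "?c e' \<phi>" and eq: "\<forall>v\<in>?I e'. \<phi> v = \<psi> v"
    show "?c e' \<psi>"
    proof (cases "e' = e")
      case True
      then obtain c where "conf e (\<phi>(v := c))" using c by auto
      then have "conf e (\<psi>(v := c))"
        by (rule conflict_cong[OF cs e(1)]) (use eq True in auto)
      then show ?thesis using True by auto
    next
      case False
      then have "conf e' \<phi>" using c by simp
      then have "conf e' \<psi>" by (rule conflict_cong[OF cs e']) (use eq False in auto)
      then show ?thesis using False by simp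
    qed
  next
    fix e' \<phi> \<psi> u z assume e': "e' \<in> E" and u: "u \<in> ?I e'" and c: "?c e' \<phi>" "?c e' \<psi>" "\<phi> u = \<psi> u"
      and z: "z \<in> ?I e'"
    show "\<phi> z = \<psi> z"
    proof (cases "e' = e")
      case True
      then obtain a b where "conf e (\<phi>(v := a))" "conf e (\<psi>(v := b))" using c by auto
      from conflict_unique[OF cs, OF e(1) this, of u z] show ?thesis
        using True u z c(3) by (auto split: if_splits)
    next
      case False
      then show ?thesis using conflict_unique[OF cs, of e' \<phi> \<psi> u z] e' c u z by auto
    qed
  qed
  have "\<not> s.hcol ?c U X \<phi>" for \<phi>
  proof
    assume h: "s.hcol ?c U X \<phi>"
    have "\<not> conf e' \<phi>" if e': "e' \<in> E" "I e' \<subseteq> U" for e'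
    proof -
      have "?I e' \<subseteq> U" using e' by auto
      then have n: "\<not> ?c e' \<phi>" using h e' unfolding s.hcol_def by blast
      show ?thesis
      proof (cases "e' = e")
        case True
        have "\<phi>(v := \<phi> v) = \<phi>" by simp
        then show ?thesis using n True by (metis fun_upd_same)
      qed (use n in simp)
    qed
    then have "hcol conf U X \<phi>" using h unfolding s.hcol_def hcol_def by simp
    then show False using unc by blast
  qed
  \<comment> \<open>\<open>S\<close> is a set on which greedy coloring of the shrunken hypergraph
    gets stuck.\<close>
  then obtain S where S: "S \<subseteq> U" "S \<noteq> {}" "\<And>x. x \<in> S \<Longrightarrow> card (X x) \<le> s.hdg S x"
    using s.hgreedy[OF fin scs, of X] by (metis not_le)
  \<comment> \<open>The degree inside \<open>S\<close> after shrinking is at least the degree in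
    \<open>U\<close> before, so a vertex of \<open>S\<close> keeps all its edges. As
    \<open>v\<close> loses \<open>e\<close>, it cannot belong to \<open>S\<close>.\<close>
  have closed: "x \<in> ?I e' \<and> ?I e' \<subseteq> S" if x: "x \<in> S" and e': "e' \<in> E" "x \<in> I e'" "I e' \<subseteq> U" for x e'
  proof -
    let ?D' = "{e' \<in> E. x \<in> ?I e' \<and> ?I e' \<subseteq> S}" and ?D = "{e' \<in> E. x \<in> I e' \<and> I e' \<subseteq> U}"
    have "?D' \<subseteq> ?D" using S(1) e by (auto split: if_splits)
    moreover have "card ?D \<le> card ?D'"
      using S(3)[OF x] le[of x] x S(1) unfolding hdg_def s.hdg_def by (meson order_trans subsetD)
    ultimately have "?D' = ?D" using finite_E by (intro card_seteq) auto
    then show ?thesis using e' by blast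
  qed
  have vS: "v \<notin> S" using closed[of v e] v e by auto
  have keep: "I e' \<subseteq> S" if "e' \<in> E" "e' \<noteq> e" "I e' \<subseteq> U" "I e' \<inter> S \<noteq> {}" for e'
    using that closed[of _ e'] by auto
  \<comment> \<open>Connectivity requires an edge leaving \<open>S\<close>, and only
    \<open>e\<close> can be one.\<close>
  have "S \<subset> U" using S(1) vS v e by blast
  from cU this S(2) obtain e' x where e': "e' \<in> E" "I e' \<subseteq> U" "x \<in> I e'" "x \<in> S" "\<not> I e' \<subseteq> S"
    by (rule hconnD)
  then have "e' = e" using keep[of e'] by blast
  then have "I e - {v} \<subseteq> S" using closed[OF e'(4,1,3,2)] by simp
  with S(1) vS show ?thesis by (intro exI[of _ S] conjI ballI impI keep)
qed

text \<open>If another edge met \<open>e\<close> at \<open>v\<close>, the separated set with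
  \<open>v\<close> added and its complement with \<open>v\<close> would form a cut, unless the
  separated set is everything but \<open>v\<close>; then the other edge would lie in
  \<open>{v}\<close>. So nothing else touches \<open>e\<close>, and connectivity gives
  \<open>I e = U\<close>.\<close>

lemma nocut_large_edge:
  assumes o: "hobs conf U X" and nc: "\<And>w U1 U2. \<not> hcut U w U1 U2"
    and e: "e \<in> E" "I e \<subseteq> U" "card (I e) \<ge> 3"
  shows "{e \<in> E. I e \<subseteq> U} = {e} \<and> I e = U"
proof -
  have cU: "hconn U" using o by (simp add: hobs_def)
  have only: "e' = e" if e': "e' \<in> E" "I e' \<subseteq> U" "v \<in> I e'" and v: "v \<in> I e" for v e'
  proof (rule ccontr)
    assume ne: "e' \<noteq> e"
    from large_edge_separates[OF o e v] obtain S where S: "S \<subseteq> U" "v \<notin> S" "I e - {v} \<subseteq> S"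
      and keep: "\<forall>e'\<in>E. e' \<noteq> e \<longrightarrow> I e' \<subseteq> U \<longrightarrow> I e' \<inter> S \<noteq> {} \<longrightarrow> I e' \<subseteq> S"
      by (elim exE conjE)
    have vU: "v \<in> U" using v e by blast
    obtain z where z: "z \<in> I e" "z \<noteq> v" using other_vertex[OF e(1)] by blast
    have "I f \<subseteq> U - S \<or> I f \<subseteq> insert v S" if f: "f \<in> E" "I f \<subseteq> U" for f
    proof (cases "f = e")
      case False
      then have "I f \<inter> S \<noteq> {} \<longrightarrow> I f \<subseteq> S" using keep f by simp
      then show ?thesis using f(2) by blast
    qed (use S(3) in blast)
    moreover have "(U - S) \<union> insert v S = U" "(U - S) \<inter> insert v S = {v}" "insert v S \<noteq> {v}"
      using S(1,2,3) vU z by auto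
    ultimately have "U - S = {v}" using nc[of v "U - S" "insert v S"] unfolding hcut_def by blast
    moreover have "I e' \<inter> S = {}"
    proof (rule ccontr)
      assume "I e' \<inter> S \<noteq> {}"
      then have "I e' \<subseteq> S" using keep e'(1,2) ne by simp
      then show False using e'(3) S(2) by blast
    qed
    ultimately have "I e' \<subseteq> {v}" using e'(2) by blast
    then show False using other_vertex[OF e'(1), of v] by blast
  qed
  have "I e = U"
  proof (rule ccontr)
    assume "I e \<noteq> U"
    then have "I e \<subset> U" "I e \<noteq> {}" using e by auto
    from cU this obtain e' x where "e' \<in> E" "I e' \<subseteq> U" "x \<in> I e'" "x \<in> I e" "\<not> I e' \<subseteq> I e"
      by (rule hconnD)
    then show False using only[of e' x] by blast
  qed
  moreover have "e' = e" if a: "e' \<in> E" "I e' \<subseteq> U" for e'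
  proof -
    obtain x where "x \<in> I e'" using other_vertex[OF a(1)] by blast
    then show ?thesis using only[OF a, of x] a(2) \<open>I e = U\<close> by blast
  qed
  ultimately show ?thesis using e by blast
qed

section \<open>From hypergraphs without cut vertices to two-connected multigraphs\<close>

lemma mult_mgraph: "mgraph mult"
proof
  show "mult u v = mult v u" for u v by (simp add: mult_def insert_commute)
  have "{e \<in> E. I e = {v, v}} = {}" for v
  proof (rule ccontr)
    assume "{e \<in> E. I e = {v, v}} \<noteq> {}"
    then obtain e where "e \<in> E" "I e = {v}" by auto
    then show False using card_I[of e] by simp
  qed
  then show "mult v v = 0" for v unfolding mult_def by (metis card.empty)
qed

text \<open>A set without edges to the rest of \<open>U - {w}\<close> becomes, with \<open>w\<close>
  added, one side of a cut at \<open>w\<close>.\<close>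

lemma nocut_two_connected:
  assumes fin: "finite U" and cU: "hconn U" and nc: "\<And>w U1 U2. \<not> hcut U w U1 U2"
    and two: "\<And>e. e \<in> E \<Longrightarrow> I e \<subseteq> U \<Longrightarrow> card (I e) = 2"
  shows "mgraph.two_connected mult U"
proof -
  interpret g: mgraph mult by (rule mult_mgraph)
  have pos: "mult s r > 0" if "e \<in> E" "I e = {s, r}" for e s r
    unfolding mult_def using that finite_E by (auto simp: card_gt_0_iff)
  have pair: "I e = {s, r}" if "e \<in> E" "I e \<subseteq> U" "s \<in> I e" "r \<in> I e" "s \<noteq> r" for e s r
    using card_subset_eq[OF finite_I[OF that(1)], of "{s, r}"] two[OF that(1,2)] that by auto
  have "g.conn U"
    unfolding g.conn_def
  proof (intro allI impI, elim conjE)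
    fix S assume S: "S \<subset> U" "S \<noteq> {}"
    from cU S obtain e s where es: "e \<in> E" "I e \<subseteq> U" "s \<in> I e" "s \<in> S" "\<not> I e \<subseteq> S" by (rule hconnD)
    then obtain r where r: "r \<in> I e" "r \<notin> S" by blast
    then have "mult s r > 0" using pos pair[OF es(1,2,3) r(1)] es by blast
    then show "\<exists>s\<in>S. \<exists>r\<in>U - S. mult s r > 0" using es r by blast
  qed
  moreover have "g.conn (U - {w})" if w: "w \<in> U" for w
    unfolding g.conn_def
  proof (intro allI impI, elim conjE, rule ccontr)
    fix S assume S: "S \<subset> U - {w}" "S \<noteq> {}" and n: "\<not> (\<exists>s\<in>S. \<exists>r\<in>U - {w} - S. mult s r > 0)"
    have "I e \<subseteq> insert w S \<or> I e \<subseteq> U - S" if e: "e \<in> E" "I e \<subseteq> U" for e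
    proof (rule ccontr)
      assume "\<not> ?thesis"
      then obtain s r where sr: "s \<in> I e" "s \<in> S" "r \<in> I e" "r \<noteq> w" "r \<notin> S" using e by blast
      then have "mult s r > 0" using pos[OF e(1) pair[OF e sr(1,3)]] by blast
      then show False using n sr e by blast
    qed
    moreover have "insert w S \<union> (U - S) = U" "insert w S \<inter> (U - S) = {w}"
      "insert w S \<noteq> {w}" "U - S \<noteq> {w}" using S w by auto
    ultimately show False using nc[of w "insert w S" "U - S"] unfolding hcut_def by blast
  qed
  ultimately show ?thesis unfolding g.two_connected_def using fin by blast
qed

lemma hdg_eq_dg:
  assumes fin: "finite U" and two: "\<And>e. e \<in> E \<Longrightarrow> I e \<subseteq> U \<Longrightarrow> card (I e) = 2" and v: "v \<in> U"
  shows "hdg U v = mgraph.dg mult U v"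
proof -
  interpret g: mgraph mult by (rule mult_mgraph)
  have "{e \<in> E. v \<in> I e \<and> I e \<subseteq> U} = (\<Union>u\<in>U - {v}. {e \<in> E. I e = {v, u}})" (is "?L = ?R")
  proof
    show "?L \<subseteq> ?R"
    proof
      fix e assume e: "e \<in> ?L"
      then obtain u where u: "u \<in> I e" "u \<noteq> v" using other_vertex by blast
      have "{v, u} = I e" by (rule card_subset_eq) (use e u finite_I two in auto)
      then show "e \<in> ?R" using e u by blast
    qed
    show "?R \<subseteq> ?L" using v by auto
  qed
  moreover have "card ?R = (\<Sum>u\<in>U - {v}. card {e \<in> E. I e = {v, u}})"
  proof (rule card_UN_disjoint)
    show "finite (U - {v})" using fin by simp
    show "\<forall>u\<in>U - {v}. finite {e \<in> E. I e = {v, u}}" using finite_E by simp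
    show "\<forall>i\<in>U - {v}. \<forall>j\<in>U - {v}. i \<noteq> j \<longrightarrow> {e \<in> E. I e = {v, i}} \<inter> {e \<in> E. I e = {v, j}} = {}"
      by (auto simp: doubleton_eq_iff)
  qed
  ultimately show ?thesis unfolding hdg_def g.dg_def mult_def by simp
qed

lemma nocut_brick:
  assumes o: "hobs conf U X" and nc: "\<And>w U1 U2. \<not> hcut U w U1 U2"
  shows "brick U" and "\<exists>d. \<forall>v\<in>U. hdg U v = d"
proof -
  have fin: "finite U" and cU: "hconn U" and cs: "conflict_system conf"
    and le: "\<And>v. v \<in> U \<Longrightarrow> hdg U v \<le> card (X v)" and finX: "\<And>v. v \<in> U \<Longrightarrow> finite (X v)"
    and unc: "\<And>\<phi>. \<not> hcol conf U X \<phi>" and neU: "U \<noteq> {}"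
    using o by (auto simp: hobs_def)
  have "brick U \<and> (\<exists>d. \<forall>v\<in>U. hdg U v = d)"
  proof (cases "\<exists>e\<in>E. I e \<subseteq> U \<and> card (I e) \<ge> 3")
    case True
    then obtain e where e: "{e \<in> E. I e \<subseteq> U} = {e}" "I e = U"
      using nocut_large_edge[OF o nc] by blast
    have "hdg U v = 1" if "v \<in> U" for v
    proof -
      have "{e \<in> E. v \<in> I e \<and> I e \<subseteq> U} = {e}" using e that by blast
      then show ?thesis by (simp add: hdg_def)
    qed
    then show ?thesis unfolding brick_def using e by blast
  next
    case False
    have two: "card (I e) = 2" if "e \<in> E" "I e \<subseteq> U" for e
      using False card_I[OF that(1)] that by force
    \<comment> \<open>\<open>A\<close> merges the conflicts of all edges with ends \<open>u\<close>
      and \<open>v\<close>; each edge contributes at most one \<open>y\<close>, whence the bound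
      \<open>mult u v\<close>.\<close>
    define A where "A u x v y \<longleftrightarrow> u \<noteq> v \<and> (\<exists>e\<in>E. I e = {u, v} \<and> conf e (\<lambda>z. if z = u then x else y))"
      for u x v y
    interpret g: mgraph mult by (rule mult_mgraph)
    have A_sub: "{y. A u x v y} \<subseteq> (\<Union>e\<in>{e \<in> E. I e = {u, v}}. {y. conf e ((\<lambda>_. x)(v := y))})"
      (is "_ \<subseteq> ?R u x v") for u x v
    proof
      fix y assume "y \<in> {y. A u x v y}"
      then obtain e where e: "u \<noteq> v" "e \<in> E" "I e = {u, v}" "conf e (\<lambda>z. if z = u then x else y)"
        unfolding A_def by blast
      have "conf e ((\<lambda>_. x)(v := y))"
        by (rule conflict_cong[OF cs, OF e(2,4)]) (use e in auto)
      then show "y \<in> ?R u x v" using e by blast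
    qed
    have finR: "finite (?R u x v)" for u x v
    proof (rule finite_UN_I)
      show "finite {e \<in> E. I e = {u, v}}" using finite_E by simp
      show "finite {y. conf e ((\<lambda>_. x)(v := y))}" if "e \<in> {e \<in> E. I e = {u, v}}" for e
        by (rule card_blocked(1)[OF cs]) (use that in auto)
    qed
    interpret c: mcover mult A
    proof
      have "A v y u x" if a: "A u x v y" for u x v y
      proof -
        obtain e where e: "u \<noteq> v" "e \<in> E" "I e = {u, v}" "conf e (\<lambda>z. if z = u then x else y)"
          using a unfolding A_def by blast
        have "conf e (\<lambda>z. if z = v then y else x)"
          by (rule conflict_cong[OF cs, OF e(2,4)]) (use e in auto)
        then show ?thesis using e insert_commute[of u v "{}"] unfolding A_def by metis
      qed
      then show "A u x v y \<longleftrightarrow> A v y u x" for u x v y by blast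
      show "finite {y. A u x v y}" for u x v using A_sub finR by (rule finite_subset)
      have "card {y. A u x v y} \<le> card (?R u x v)" for u x v by (rule card_mono[OF finR A_sub])
      also have "card (?R u x v) \<le> (\<Sum>e\<in>{e \<in> E. I e = {u, v}}. card {y. conf e ((\<lambda>_. x)(v := y))})" for u x v
        using finite_E by (intro card_UN_le) simp
      also have "\<dots> u x v \<le> (\<Sum>e\<in>{e \<in> E. I e = {u, v}}. 1)" for u x v
        by (intro sum_mono card_blocked(2)[OF cs]) auto
      finally show "card {y. A u x v y} \<le> mult u v" for u x v by (simp add: mult_def)
    qed
    have tc: "g.two_connected U" using nocut_two_connected[OF fin cU nc two] .
    have dge: "hdg U v = g.dg U v" if "v \<in> U" for v using hdg_eq_dg[OF fin two that] .
    have "c.obs U X"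
      unfolding c.obs_def
    proof (intro conjI ballI notI)
      show "g.conn U" using tc by (simp add: g.two_connected_def)
      show "finite (X v)" "g.dg U v \<le> card (X v)" if "v \<in> U" for v
        using finX le dge that by auto
      assume "\<exists>\<phi>. c.col U X \<phi>"
      then obtain \<phi> where \<phi>: "c.col U X \<phi>" by blast
      have "\<not> conf e \<phi>" if e: "e \<in> E" "I e \<subseteq> U" for e
      proof
        assume c: "conf e \<phi>"
        obtain u v where uv: "I e = {u, v}" "u \<noteq> v" using two[OF e] by (meson card_2_iff)
        have "conf e (\<lambda>z. if z = u then \<phi> u else \<phi> v)"
          by (rule conflict_cong[OF cs, OF e(1) c]) (use uv in auto)
        then have "A u (\<phi> u) v (\<phi> v)" using uv e by (auto simp: A_def)
        then show False using \<phi> uv e unfolding c.col_def by blast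
      qed
      then have "hcol conf U X \<phi>" using \<phi> unfolding hcol_def c.col_def by blast
      then show False using unc by blast
    qed (use fin neU in auto)
    note res = c.obs_two_connected[OF this tc]
    have "brick U" unfolding brick_def using two res(1) by blast
    moreover have "\<exists>d. \<forall>v\<in>U. hdg U v = d" using res(2) dge by simp
    ultimately show ?thesis by blast
  qed
  then show "brick U" "\<exists>d. \<forall>v\<in>U. hdg U v = d" by auto
qed

text \<open>The root \<open>r\<close> absorbs the loss of degree at a cut vertex.\<close>

lemma rooted_brooks:
  assumes "hobs conf U X" and "r \<in> U" "\<And>v. v \<in> U \<Longrightarrow> v \<noteq> r \<Longrightarrow> hdg U v = D" "hdg U r \<le> D"
  shows "brick U \<and> (\<exists>d. \<forall>v\<in>U. hdg U v = d)"
  using assms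
proof (induction "card U" arbitrary: U X r rule: less_induct)
  case less
  have fin: "finite U" and cU: "hconn U" using less.prems by (auto simp: hobs_def)
  show ?case
  proof (cases "\<exists>w U1 U2. hcut U w U1 U2")
    case False
    then show ?thesis using nocut_brick[OF less.prems(1)] by blast
  next
    case True
    then obtain w U1 U2 where cut: "hcut U w U1 U2" by blast
    \<comment> \<open>Only \<open>w\<close> can be deficient in \<open>V\<close>, so it serves as
      the root there. By induction \<open>V\<close> is regular, of degree \<open>D\<close> because
      it has a vertex besides \<open>w\<close>; but \<open>w\<close> also has an edge in
      \<open>W\<close>, so its degree in \<open>U\<close> would exceed \<open>D\<close>.\<close>
    have impossible: False if c: "hcut U w V W" and rV: "r \<in> V \<Longrightarrow> r = w" for V W
    proof -
      have V: "V \<union> W = U" "V \<inter> W = {w}" "V \<noteq> {w}" "W \<noteq> {w}" using c by (auto simp: hcut_def)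
      obtain A where A: "hobs conf V (X(w := A))" using hobs_hcut[OF less.prems(1) c] by blast
      have wU: "hdg U w \<le> D" using less.prems(2-4) V by (cases "w = r") auto
      have sum: "hdg U w = hdg V w + hdg W w" using hdg_hcut_sum[OF c] .
      have dV: "hdg V v = D" if "v \<in> V" "v \<noteq> w" for v
        using hdg_hcut_other[OF c that] less.prems(3)[of v] that rV V by auto
      obtain x where x: "x \<in> W" "x \<noteq> w" using V by blast
      then have "V \<subset> U" using V by blast
      then have "card V < card U" by (rule psubset_card_mono[OF fin])
      then have "\<exists>d. \<forall>v\<in>V. hdg V v = d"
        using less.hyps[of V "X(w := A)" w] A V dV wU sum by force
      moreover obtain y where "y \<in> V" "y \<noteq> w" using V by blast
      ultimately have "hdg V w = D" using dV V by (metis IntD1 singletonI)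
      moreover have "hdg W w > 0"
      proof -
        have cW: "hconn W" using hcut_hconn[OF cU] c hcut_sym by blast
        have "{w} \<subset> W" "{w} \<noteq> {}" using x V by auto
        from cW this obtain e s where "e \<in> E" "I e \<subseteq> W" "s \<in> I e" "s \<in> {w}" "\<not> I e \<subseteq> {w}"
          by (rule hconnD)
        then have "{e \<in> E. w \<in> I e \<and> I e \<subseteq> W} \<noteq> {}" by blast
        then show ?thesis unfolding hdg_def using finite_E by (simp add: card_gt_0_iff)
      qed
      ultimately show False using sum wU by linarith
    qed
    \<comment> \<open>The root lies on both sides only if it is \<open>w\<close>, so at least one
      side meets the condition on \<open>V\<close>.\<close>
    have "r \<in> U1 \<inter> U2 \<Longrightarrow> r = w" using cut by (auto simp: hcut_def)
    then show ?thesis using impossible[OF cut] impossible[of U2 U1] cut hcut_sym by blast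
  qed
qed

end

section \<open>Covers of hypergraphs\<close>

sublocale hypergraph \<subseteq> hs: hsys "edges G" "inc G"
  by unfold_locales (use finite_edges card_inc inc_subset finite_verts finite_subset in blast)+

context hypergraph begin

lemma degree_eq_hdg: "degree G v = hs.hdg (verts G) v"
  unfolding degree_def hs.hdg_def using inc_subset by (metis (no_types, lifting))

lemma degree_le_max_degree: "v \<in> verts G \<Longrightarrow> degree G v \<le> max_degree G"
  unfolding max_degree_def using finite_verts by simp

lemma max_degree_le:
  assumes "\<And>v. v \<in> verts G \<Longrightarrow> degree G v \<le> d"
  shows "max_degree G \<le> d"
  unfolding max_degree_def using finite_verts assms by simp

lemma hdg_le_degree: "hs.hdg S v \<le> degree G v"
  unfolding degree_def hs.hdg_def using finite_edges by (intro card_mono) auto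

lemma list_crossing:
  assumes "xs \<noteq> []" "hd xs \<in> S" "last xs \<notin> S"
  shows "\<exists>j. Suc j < length xs \<and> xs ! j \<in> S \<and> xs ! Suc j \<notin> S"
  using assms
proof (induction xs)
  case (Cons x xs)
  show ?case
  proof (cases "xs \<noteq> [] \<and> hd xs \<in> S")
    case True
    then obtain j where "Suc j < length xs" "xs ! j \<in> S" "xs ! Suc j \<notin> S"
      using Cons by auto
    then show ?thesis by (intro exI[of _ "Suc j"]) simp
  next
    case False
    then have "xs \<noteq> []" "hd xs \<notin> S" using Cons.prems by auto
    then show ?thesis using Cons.prems by (intro exI[of _ 0]) (simp add: hd_conv_nth)
  qed
qed simp

lemma connected_hconn:
  assumes "connected_hypergraph G"
  shows "hs.hconn (verts G)"
  unfolding hs.hconn_def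
proof (intro allI impI, elim conjE)
  fix S assume S: "S \<subset> verts G" "S \<noteq> {}"
  then obtain s r where sr: "s \<in> S" "r \<in> verts G" "r \<notin> S" by blast
  then have "joined G s r" using assms S by (auto simp: connected_hypergraph_def)
  then obtain vs es where p: "length vs = Suc (length es)" "set es \<subseteq> edges G" "hd vs = s" "last vs = r"
    "\<forall>j < length es. {vs ! j, vs ! Suc j} \<subseteq> inc G (es ! j)"
    unfolding joined_def by blast
  have "vs \<noteq> []" using p(1) by auto
  then obtain j where j: "Suc j < length vs" "vs ! j \<in> S" "vs ! Suc j \<notin> S"
    using list_crossing[of vs S] sr p by blast
  then have "j < length es" using p(1) by simp
  then have "es ! j \<in> edges G" "{vs ! j, vs ! Suc j} \<subseteq> inc G (es ! j)" using p by auto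
  then show "\<exists>e\<in>edges G. inc G e \<subseteq> verts G \<and> inc G e \<inter> S \<noteq> {} \<and> \<not> inc G e \<subseteq> S"
    using inc_subset j by blast
qed

text \<open>A choice conflicts on \<open>e\<close> when it picks exactly an edge of the matching
  \<open>M e\<close>; uniqueness holds because these edges are disjoint and meet each class once. An
  edge inside a chosen transversal meets every class over \<open>e\<close> in the chosen color, so
  it is a conflict.\<close>

lemma cover_conflict_system:
  fixes X :: "'v \<Rightarrow> 'x set" and H :: "('x, 'f) hypergraph_rec"
  assumes cov: "is_cover G X H"
  shows "\<exists>conf. hs.conflict_system conf \<and> (\<forall>\<phi>. hs.hcol conf (verts G) X \<phi> \<longrightarrow> cover_colorable G X H)"
proof -
  obtain M where H: "hypergraph H"
    and disj: "\<forall>u \<in> verts G. \<forall>v \<in> verts G. u \<noteq> v \<longrightarrow> X u \<inter> X v = {}"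
    and VH: "verts H = (\<Union>v \<in> verts G. X v)"
    and M: "\<forall>e \<in> edges G. matching (induced H (\<Union>v \<in> inc G e. X v)) (M e) \<and>
          (\<forall>h \<in> M e. \<forall>v \<in> inc G e. card (inc H h \<inter> X v) = 1)"
    and EH: "edges H = (\<Union>e \<in> edges G. M e)"
    using cov unfolding is_cover_def by (elim conjE exE) (rule that)
  define conf where "conf e \<phi> \<longleftrightarrow> (\<forall>v\<in>inc G e. \<phi> v \<in> X v) \<and> (\<exists>f\<in>M e. inc H f = \<phi> ` inc G e)"
    for e \<phi>
  have "hs.conflict_system conf"
    unfolding hs.conflict_system_def
  proof (intro conjI ballI allI impI)
    fix e and \<phi> \<psi> :: "'v \<Rightarrow> 'x" assume "conf e \<phi>" and eq: "\<forall>v\<in>inc G e. \<phi> v = \<psi> v"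
    moreover from eq have "\<phi> ` inc G e = \<psi> ` inc G e" by (intro image_cong) auto
    ultimately show "conf e \<psi>" unfolding conf_def by simp
  next
    fix e u v and \<phi> \<psi> :: "'v \<Rightarrow> 'x"
    assume e: "e \<in> edges G" and u: "u \<in> inc G e" and c: "conf e \<phi>" "conf e \<psi>" and uu: "\<phi> u = \<psi> u"
      and v: "v \<in> inc G e"
    obtain f g where fg: "f \<in> M e" "inc H f = \<phi> ` inc G e" "g \<in> M e" "inc H g = \<psi> ` inc G e"
      using c by (auto simp: conf_def)
    have "\<phi> u \<in> inc H f" unfolding fg(2) using u by (rule imageI)
    moreover have "\<phi> u \<in> inc H g" unfolding fg(4) uu using u by (rule imageI)
    ultimately
    have ne: "inc H f \<inter> inc H g \<noteq> {}" by blast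
    have "\<forall>f\<in>M e. \<forall>g\<in>M e. f \<noteq> g \<longrightarrow> inc H f \<inter> inc H g = {}"
      using bspec[OF M e] unfolding matching_def induced_def by simp
    then have "f = g" using ne fg(1,3) by blast
    then have eq: "\<phi> ` inc G e = \<psi> ` inc G e" using fg by simp
    have "card (inc H f \<inter> X v) = 1" using M e fg(1) v by blast
    moreover have "\<phi> v \<in> inc H f \<inter> X v" using c(1) v fg(2) by (auto simp: conf_def)
    moreover have "\<psi> v \<in> inc H f \<inter> X v" using c(2) v fg(2) eq by (auto simp: conf_def)
    ultimately show "\<phi> v = \<psi> v" by (metis card_1_singletonE singletonD)
  qed
  moreover have "cover_colorable G X H" if h: "hs.hcol conf (verts G) X \<phi>" for \<phi>
  proof -
    have \<phi>: "\<phi> v \<in> X v" if "v \<in> verts G" for v using h that by (simp add: hs.hcol_def)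
    have Tv: "\<phi> ` verts G \<inter> X v = {\<phi> v}" if v: "v \<in> verts G" for v
    proof -
      have "u = v" if u: "u \<in> verts G" "\<phi> u \<in> X v" for u
        using disj u v \<phi>[OF u(1)] by (meson disjoint_iff)
      then show ?thesis using \<phi>[OF v] v by blast
    qed
    have "independent H (\<phi> ` verts G)"
    proof -
      have "\<not> inc H f \<subseteq> \<phi> ` verts G" if f: "f \<in> edges H" for f
      proof
        assume sub: "inc H f \<subseteq> \<phi> ` verts G"
        obtain e where e: "e \<in> edges G" "f \<in> M e" using f EH by blast
        have fU: "inc H f \<subseteq> (\<Union>v \<in> inc G e. X v)"
          using bspec[OF M e(1)] e(2) unfolding matching_def induced_def by auto
        have fv: "inc H f \<inter> X v = {\<phi> v}" if v: "v \<in> inc G e" for v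
        proof -
          have "v \<in> verts G" using inc_subset[OF e(1)] v by blast
          then have "inc H f \<inter> X v \<subseteq> {\<phi> v}" using Tv sub by blast
          moreover have "card (inc H f \<inter> X v) = 1" using M e v by blast
          ultimately show ?thesis by (metis card.empty subset_singleton_iff zero_neq_one)
        qed
        have "inc H f = \<phi> ` inc G e"
        proof
          show "inc H f \<subseteq> \<phi> ` inc G e"
          proof
            fix x assume x: "x \<in> inc H f"
            then obtain v where "v \<in> inc G e" "x \<in> X v" using fU by blast
            then show "x \<in> \<phi> ` inc G e" using fv[of v] x by blast
          qed
          show "\<phi> ` inc G e \<subseteq> inc H f" using fv by blast
        qed
        then have "conf e \<phi>" unfolding conf_def using e \<phi> inc_subset[OF e(1)] by blast
        then show False using h e inc_subset unfolding hs.hcol_def by blast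
      qed
      moreover have "\<phi> ` verts G \<subseteq> verts H" using \<phi> VH by blast
      ultimately show ?thesis unfolding independent_def induced_def by auto
    qed
    then show ?thesis unfolding cover_colorable_def using Tv by (intro exI[of _ "\<phi> ` verts G"]) simp
  qed
  ultimately show ?thesis by blast
qed

lemma cover_finite:
  assumes cov: "is_cover G X H" and v: "v \<in> verts G"
  shows "finite (X v)"
proof -
  have "X v \<subseteq> verts H" "hypergraph H" using cov v unfolding is_cover_def by auto
  then show ?thesis using hypergraph.finite_verts finite_subset by blast
qed

lemma dp_colorable_Suc_max_degree: "dp_colorable G (max_degree G + 1)"
  unfolding dp_colorable_def
proof (intro allI impI, elim conjE)
  fix X :: "'v \<Rightarrow> nat set" and H :: "(nat, nat) hypergraph_rec"
  assume cov: "is_cover G X H" and large: "\<forall>v\<in>verts G. max_degree G + 1 \<le> card (X v)"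
  obtain conf where cs: "hs.conflict_system conf"
    and colH: "\<And>\<phi>. hs.hcol conf (verts G) X \<phi> \<Longrightarrow> cover_colorable G X H"
    using cover_conflict_system[OF cov] by blast
  have "\<exists>\<phi>. hs.hcol conf (verts G) X \<phi>"
  proof (rule hs.hgreedy[OF finite_verts cs])
    fix S assume S: "S \<subseteq> verts G" "S \<noteq> {}"
    then obtain v where v: "v \<in> S" "v \<in> verts G" by blast
    then have "hs.hdg S v < card (X v)"
      using hdg_le_degree[of S v] degree_le_max_degree[OF v(2)] large by fastforce
    then show "\<exists>v\<in>S. hs.hdg S v < card (X v)" using v by blast
  qed
  then show "cover_colorable G X H" using colH by blast
qed

lemma not_dp_colorable_brick:
  assumes conn: "connected_hypergraph G" and n: "\<not> dp_colorable G (max_degree G)"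
  shows "hs.brick (verts G)" "verts G \<noteq> {}"
proof -
  obtain X :: "'v \<Rightarrow> nat set" and H :: "(nat, nat) hypergraph_rec"
    where cov: "is_cover G X H" and large: "\<forall>v\<in>verts G. max_degree G \<le> card (X v)"
      and nc: "\<not> cover_colorable G X H"
    using n unfolding dp_colorable_def by blast
  obtain conf where cs: "hs.conflict_system conf"
    and colH: "\<And>\<phi>. hs.hcol conf (verts G) X \<phi> \<Longrightarrow> cover_colorable G X H"
    using cover_conflict_system[OF cov] by blast
  \<comment> \<open>Without vertices the empty choice is a coloring, so the empty hypergraph never
    fails.\<close>
  show ne: "verts G \<noteq> {}"
  proof
    assume "verts G = {}"
    then have "\<exists>\<phi>. hs.hcol conf (verts G) X \<phi>"
      by (intro hs.hgreedy[OF finite_verts cs]) simp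
    then show False using colH nc by blast
  qed
  have le: "hs.hdg (verts G) v \<le> max_degree G" "max_degree G \<le> card (X v)" if "v \<in> verts G" for v
    using degree_le_max_degree[OF that] degree_eq_hdg[of v] large that by auto
  have o: "hs.hobs conf (verts G) X"
    unfolding hs.hobs_def
  proof (intro conjI ballI)
    show "finite (verts G)" by (rule finite_verts)
    show "hs.hconn (verts G)" using connected_hconn[OF conn] .
    show "\<nexists>\<phi>. hs.hcol conf (verts G) X \<phi>" using colH nc by blast
    show "hs.hdg (verts G) v \<le> card (X v)" if "v \<in> verts G" for v
      using le[OF that] by linarith
  qed (use ne cs cover_finite[OF cov] in auto)
  \<comment> \<open>Tightness turns class sizes of at least \<open>max_degree G\<close> into
    regularity, so any vertex can serve as root.\<close>
  have eq: "hs.hdg (verts G) v = max_degree G" if "v \<in> verts G" for v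
    using hs.hobs_tight[OF o that] le[OF that] by linarith
  obtain r where "r \<in> verts G" using ne by blast
  then show "hs.brick (verts G)" using hs.rooted_brooks[OF o, of r "max_degree G"] eq by simp
qed

section \<open>From bricks to DP-hyperbricks\<close>

text \<open>The edges over each \<open>A\<close> in \<open>F\<close> are numbered separately by
  \<open>h A\<close>; \<open>A\<close> together with this number is the image edge.\<close>

lemma iso_multiple_graph:
  assumes f: "bij_betw f V (verts G)" and F: "\<And>A. A \<in> F \<Longrightarrow> A \<subseteq> V"
    and inc: "\<And>e. e \<in> edges G \<Longrightarrow> \<exists>A\<in>F. inc G e = f ` A"
    and card: "\<And>A. A \<in> F \<Longrightarrow> card {e \<in> edges G. inc G e = f ` A} = t"
  shows "hypergraph_iso G (multiple_graph t V F)"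
proof -
  let ?C = "\<lambda>A. {e \<in> edges G. inc G e = f ` A}"
  define g where "g = the_inv_into V f"
  have gf: "g ` f ` A = A" if "A \<subseteq> V" for A
    using f that unfolding g_def bij_betw_def
    by (simp add: image_image subset_iff the_inv_into_f_f cong: image_cong)
  have "\<exists>h. bij_betw h (?C A) {..<t}" if "A \<in> F" for A
    using ex_bij_betw_finite_nat[of "?C A"] finite_edges card[OF that] by (simp add: atLeast0LessThan)
  then obtain h where h: "\<And>A. A \<in> F \<Longrightarrow> bij_betw (h A) (?C A) {..<t}" by metis
  define \<psi> where "\<psi> e = (g ` inc G e, h (g ` inc G e) e)" for e
  have \<psi>: "\<psi> e = (A, h A e)" if "A \<in> F" "inc G e = f ` A" for e A
    using that gf[OF F[OF that(1)]] by (simp add: \<psi>_def)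
  have "bij_betw \<psi> (edges G) (F \<times> {..<t})"
    unfolding bij_betw_def
  proof
    show "inj_on \<psi> (edges G)"
    proof (rule inj_onI)
      fix e e' assume e: "e \<in> edges G" "e' \<in> edges G" "\<psi> e = \<psi> e'"
      obtain A B where AB: "A \<in> F" "inc G e = f ` A" "B \<in> F" "inc G e' = f ` B"
        using inc e by meson
      have "(A, h A e) = (B, h B e')" using e(3) \<psi> AB by metis
      then have "A = B" "h A e = h A e'" by auto
      moreover have "inj_on (h A) (?C A)" using h[OF AB(1)] by (simp add: bij_betw_def)
      ultimately show "e = e'" using AB e by (auto dest: inj_onD)
    qed
    show "\<psi> ` edges G = F \<times> {..<t}"
    proof
      show "\<psi> ` edges G \<subseteq> F \<times> {..<t}"
      proof
        fix p assume "p \<in> \<psi> ` edges G"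
        then obtain e where e: "e \<in> edges G" "p = \<psi> e" by blast
        then obtain A where A: "A \<in> F" "inc G e = f ` A" using inc by blast
        have "h A e \<in> {..<t}" using h[OF A(1)] e A unfolding bij_betw_def by blast
        then show "p \<in> F \<times> {..<t}" using e A \<psi> by auto
      qed
      show "F \<times> {..<t} \<subseteq> \<psi> ` edges G"
      proof
        fix p assume "p \<in> F \<times> {..<t}"
        then obtain A k where p: "p = (A, k)" "A \<in> F" "k \<in> {..<t}" by blast
        then have "k \<in> h A ` ?C A" using h[OF p(2)] by (simp add: bij_betw_def)
        then obtain e where e: "e \<in> edges G" "inc G e = f ` A" "k = h A e" by blast
        then have "p = \<psi> e" using \<psi>[OF p(2)] p by simp
        then show "p \<in> \<psi> ` edges G" using e by blast
      qed
    qed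
  qed
  moreover have "bij_betw g (verts G) V"
    unfolding g_def using f by (rule bij_betw_the_inv_into)
  moreover have "fst (\<psi> e) = g ` inc G e" for e by (simp add: \<psi>_def)
  ultimately show ?thesis
    unfolding hypergraph_iso_def multiple_graph_def by (intro exI[of _ g] exI[of _ \<psi>]) simp
qed

lemma brick_dp_hyperbrick:
  assumes b: "hs.brick (verts G)" and ne: "verts G \<noteq> {}"
  shows "dp_hyperbrick G"
proof -
  have all: "{e \<in> edges G. inc G e \<subseteq> verts G} = edges G" using inc_subset by auto
  interpret g: mgraph hs.mult by (rule hs.mult_mgraph)
  consider (edge) e where "edges G = {e}" "inc G e = verts G"
    | (K) t where "\<forall>e\<in>edges G. card (inc G e) = 2" "t \<ge> 1"
        "\<forall>u\<in>verts G. \<forall>v\<in>verts G. u \<noteq> v \<longrightarrow> hs.mult u v = t"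
    | (C) t n f where "\<forall>e\<in>edges G. card (inc G e) = 2" "t \<ge> 1" "n \<ge> 3" "bij_betw f {..<n} (verts G)"
        "\<forall>i<n. \<forall>j<n. hs.mult (f i) (f j) = (if j = Suc i mod n \<or> i = Suc j mod n then t else 0)"
  proof -
    from b[unfolded hs.brick_def all] show thesis
    proof (elim disjE conjE exE)
      fix e assume "edges G = {e}" "inc G e = verts G"
      then show thesis by (rule edge)
    next
      fix t assume "\<forall>e\<in>edges G. inc G e \<subseteq> verts G \<longrightarrow> card (inc G e) = 2" "1 \<le> t"
        "\<forall>u\<in>verts G. \<forall>v\<in>verts G. u \<noteq> v \<longrightarrow> hs.mult u v = t"
      then show thesis using inc_subset by (intro K[of t]) simp_all
    next
      fix t n f assume "\<forall>e\<in>edges G. inc G e \<subseteq> verts G \<longrightarrow> card (inc G e) = 2" "1 \<le> t" "3 \<le> n"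
        "bij_betw f {..<n} (verts G)"
        "\<forall>i<n. \<forall>j<n. hs.mult (f i) (f j) = (if j = Suc i mod n \<or> i = Suc j mod n then t else 0)"
      then show thesis using inc_subset by (intro C[of t n f]) simp_all
    qed
  qed
  then show ?thesis
  proof cases
    case edge
    then show ?thesis unfolding dp_hyperbrick_def by blast
  next
    case K
    define n where "n = card (verts G)"
    have n: "n \<ge> 1" using ne finite_verts by (simp add: n_def Suc_le_eq card_gt_0_iff)
    obtain f where f: "bij_betw f {..<n} (verts G)"
      using ex_bij_betw_nat_finite[OF finite_verts] by (auto simp: n_def atLeast0LessThan)
    have fv: "f i \<in> verts G" if "i < n" for i using f that by (auto simp: bij_betw_def)
    have "hypergraph_iso G (tK t n)"
      unfolding tK_def
    proof (rule iso_multiple_graph[OF f])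
      fix e assume e: "e \<in> edges G"
      then obtain u v where uv: "inc G e = {u, v}" "u \<noteq> v" using K(1) by (meson card_2_iff)
      then have "u \<in> f ` {..<n}" "v \<in> f ` {..<n}"
        using inc_subset[OF e] f by (auto simp: bij_betw_def)
      then obtain i j where ij: "i < n" "j < n" "u = f i" "v = f j" by auto
      then have "{i, j} \<in> {{i, j} |i j. i < n \<and> j < n \<and> i \<noteq> j}" "inc G e = f ` {i, j}"
        using uv by auto
      then show "\<exists>A\<in>{{i, j} |i j. i < n \<and> j < n \<and> i \<noteq> j}. inc G e = f ` A" by (rule rev_bexI)
    next
      fix A assume "A \<in> {{i, j} |i j. i < n \<and> j < n \<and> i \<noteq> j}"
      then obtain i j where ij: "A = {i, j}" "i < n" "j < n" "i \<noteq> j" by blast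
      then show "A \<subseteq> {..<n}" by simp
      have "f i \<noteq> f j" using f ij by (auto simp: bij_betw_def inj_on_def)
      then show "card {e \<in> edges G. inc G e = f ` A} = t"
        using K(3) fv ij by (auto simp: hs.mult_def)
    qed
    then show ?thesis unfolding dp_hyperbrick_def using K(2) n by blast
  next
    case C
    have fv: "f i \<in> verts G" if "i < n" for i using C(4) that by (auto simp: bij_betw_def)
    have "hypergraph_iso G (tC t n)"
      unfolding tC_def
    proof (rule iso_multiple_graph[OF C(4)])
      fix e assume e: "e \<in> edges G"
      then obtain u v where uv: "inc G e = {u, v}" "u \<noteq> v" using C(1) by (meson card_2_iff)
      then have "u \<in> f ` {..<n}" "v \<in> f ` {..<n}"
        using inc_subset[OF e] C(4) by (auto simp: bij_betw_def)
      then obtain i j where ij: "i < n" "j < n" "u = f i" "v = f j" by auto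
      have "{e \<in> edges G. inc G e = {f i, f j}} \<noteq> {}" using e uv ij by blast
      then have "hs.mult (f i) (f j) \<noteq> 0" using finite_edges by (simp add: hs.mult_def)
      then have "j = Suc i mod n \<or> i = Suc j mod n" using C(5) ij by metis
      then have "{i, j} \<in> {{i, Suc i mod n} |i. i < n}" using ij by (auto simp: insert_commute)
      moreover have "inc G e = f ` {i, j}" using uv ij by auto
      ultimately show "\<exists>A\<in>{{i, Suc i mod n} |i. i < n}. inc G e = f ` A" by (rule rev_bexI)
    next
      fix A assume "A \<in> {{i, Suc i mod n} |i. i < n}"
      then obtain i where i: "A = {i, Suc i mod n}" "i < n" by blast
      moreover have "Suc i mod n < n" using i by simp
      ultimately show "A \<subseteq> {..<n}" by simp
      have "hs.mult (f i) (f (Suc i mod n)) = t" using C(5) i \<open>Suc i mod n < n\<close> by simp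
      then show "card {e \<in> edges G. inc G e = f ` A} = t" using i by (simp add: hs.mult_def)
    qed
    then show ?thesis unfolding dp_hyperbrick_def using C by blast
  qed
qed

end


section \<open>Lower bound: covers of hyperbricks without coloring\<close>

text \<open>Each color class is divided into \<open>b\<close> blocks of \<open>t\<close> colors; the condition
\<open>(i + j) mod t = idx e\<close> decomposes the complete bipartite graph between two blocks into \<open>t\<close>
perfect matchings. The flag \<open>s e\<close> tells whether equal or different blocks are joined.\<close>

definition block_matching :: "('v, 'e) hypergraph_rec \<Rightarrow> nat \<Rightarrow> nat \<Rightarrow> ('e \<Rightarrow> nat) \<Rightarrow> ('e \<Rightarrow> bool) \<Rightarrow>
    'e \<Rightarrow> ('v \<times> nat \<times> nat) set set" where
  "block_matching G b t idx s e = {{(u, \<beta>, i), (v, \<gamma>, j)} | u v \<beta> \<gamma> i j.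
     inc G e = {u, v} \<and> u \<noteq> v \<and> \<beta> < b \<and> \<gamma> < b \<and> i < t \<and> j < t \<and>
     (i + j) mod t = idx e \<and> (\<beta> = \<gamma>) = s e}"

definition block_cover :: "('v, 'e) hypergraph_rec \<Rightarrow> nat \<Rightarrow> nat \<Rightarrow> ('e \<Rightarrow> nat) \<Rightarrow> ('e \<Rightarrow> bool) \<Rightarrow>
    ('v \<times> nat \<times> nat, ('v \<times> nat \<times> nat) set) hypergraph_rec" where
  "block_cover G b t idx s =
     \<lparr>verts = (\<Union>v\<in>verts G. {v} \<times> {..<b} \<times> {..<t}),
      edges = (\<Union>e\<in>edges G. block_matching G b t idx s e), inc = id\<rparr>"

text \<open>Symmetry of the index and block conditions lets either end be listed first.\<close>

lemma block_matchingE: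
  assumes "f \<in> block_matching G b t idx s e" "(u, \<beta>, i) \<in> f"
  obtains v \<gamma> j where "f = {(u, \<beta>, i), (v, \<gamma>, j)}" "inc G e = {u, v}" "u \<noteq> v" "\<beta> < b" "\<gamma> < b"
    "i < t" "j < t" "(i + j) mod t = idx e" "(\<beta> = \<gamma>) = s e"
proof -
  obtain u' v' \<beta>' \<gamma>' i' j' where f: "f = {(u', \<beta>', i'), (v', \<gamma>', j')}" and
    c: "inc G e = {u', v'}" "u' \<noteq> v'" "\<beta>' < b" "\<gamma>' < b"
    "i' < t" "j' < t" "(i' + j') mod t = idx e" "(\<beta>' = \<gamma>') = s e"
    using assms(1) unfolding block_matching_def by blast
  consider "(u, \<beta>, i) = (u', \<beta>', i')" | "(u, \<beta>, i) = (v', \<gamma>', j')" using assms(2) f by blast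
  then show thesis
  proof cases
    case 1
    then show thesis using that[of v' \<gamma>' j'] f c by simp
  next
    case 2
    then show thesis using that[of u' \<beta>' i'] f c by (auto simp: insert_commute add.commute)
  qed
qed

lemma add_mod_cancel_nat:
  fixes i j j' t :: nat
  assumes "(i + j) mod t = (i + j') mod t" "j < t" "j' < t"
  shows "j = j'"
proof -
  have le: "a \<le> c" if "(i + a) mod t = (i + c) mod t" "a < t" for a c
  proof (rule ccontr)
    assume "\<not> a \<le> c"
    moreover then have "t dvd a - c"
      using that(1) mod_eq_dvd_iff_nat[of "i + c" "i + a" t] by simp
    ultimately show False using that(2) dvd_imp_le[of t "a - c"] by simp
  qed
  show ?thesis using le[of j j'] le[of j' j] assms by simp
qed

context hypergraph begin

text \<open>Given one end of a matching edge, the index fixes \<open>j\<close>, and equality of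
  blocks fixes \<open>\<gamma>\<close>. A different block is determined only if there are just two,
  whence the hypothesis \<open>s\<close>.\<close>

lemma block_cover_is_cover:
  assumes s: "b = 2 \<or> (\<forall>e\<in>edges G. s e)" and two: "\<And>e. e \<in> edges G \<Longrightarrow> card (inc G e) = 2"
  shows "is_cover G (\<lambda>v. {v} \<times> {..<b} \<times> {..<t}) (block_cover G b t idx s)"
proof -
  let ?X = "\<lambda>v. {v} \<times> {..<b} \<times> {..<t}"
  let ?M = "block_matching G b t idx s"
  let ?H = "block_cover G b t idx s"
  have sub: "f \<subseteq> (\<Union>v\<in>inc G e. ?X v)" if "f \<in> ?M e" for f e
    using that unfolding block_matching_def by auto
  have card2: "card f = 2" if "f \<in> ?M e" for f e
    using that unfolding block_matching_def by auto
  have inter: "card (f \<inter> ?X v) = 1" if f: "f \<in> ?M e" and v: "v \<in> inc G e" for f e v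
  proof -
    obtain u w \<beta> \<gamma> i j where f: "f = {(u, \<beta>, i), (w, \<gamma>, j)}" and
      c: "inc G e = {u, w}" "u \<noteq> w" "\<beta> < b" "\<gamma> < b" "i < t" "j < t"
      using f unfolding block_matching_def by blast
    have "f \<inter> ?X u = {(u, \<beta>, i)}" "f \<inter> ?X w = {(w, \<gamma>, j)}" using f c by auto
    moreover have "v = u \<or> v = w" using v c by blast
    ultimately show ?thesis by (metis One_nat_def card.empty card.insert empty_iff finite.emptyI)
  qed
  have disj: "f \<inter> g = {}" if fg: "f \<in> ?M e" "g \<in> ?M e" "f \<noteq> g" and e: "e \<in> edges G" for f g e
  proof (rule ccontr)
    assume "f \<inter> g \<noteq> {}"
    then obtain u \<beta> i where p: "(u, \<beta>, i) \<in> f" "(u, \<beta>, i) \<in> g" by (metis Int_iff all_not_in_conv prod_cases3)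
    obtain v \<gamma> j where f: "f = {(u, \<beta>, i), (v, \<gamma>, j)}" "inc G e = {u, v}" "u \<noteq> v" "\<gamma> < b"
      "j < t" "(i + j) mod t = idx e" "(\<beta> = \<gamma>) = s e" "\<beta> < b"
      by (rule block_matchingE[OF fg(1) p(1)])
    obtain v' \<gamma>' j' where g: "g = {(u, \<beta>, i), (v', \<gamma>', j')}" "inc G e = {u, v'}" "u \<noteq> v'" "\<gamma>' < b"
      "j' < t" "(i + j') mod t = idx e" "(\<beta> = \<gamma>') = s e"
      by (rule block_matchingE[OF fg(2) p(2)])
    have "v = v'" using f(2,3) g(2,3) by (auto simp: doubleton_eq_iff)
    moreover have "j = j'" using add_mod_cancel_nat[of i j t j'] f(5,6) g(5,6) by simp
    moreover have "\<gamma> = \<gamma>'"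
    proof (cases "s e")
      case False
      then have "b = 2" using s e by blast
      then show ?thesis using False f(4,7,8) g(4,7) by auto
    qed (use f(7) g(7) in simp)
    ultimately show False using f(1) g(1) fg(3) by simp
  qed
  have H: "verts ?H = (\<Union>v\<in>verts G. ?X v)" "edges ?H = (\<Union>e\<in>edges G. ?M e)" "inc ?H f = f" for f
    by (simp_all add: block_cover_def)
  have subV: "(\<Union>v\<in>inc G e. ?X v) \<subseteq> verts ?H" if "e \<in> edges G" for e
    unfolding H(1) using inc_subset[OF that] by (rule UN_mono) simp
  show ?thesis
    unfolding is_cover_def
  proof (intro conjI ballI impI)
    show "hypergraph ?H"
    proof
      show fin: "finite (verts ?H)" unfolding H(1) using finite_verts by auto
      have "edges ?H \<subseteq> Pow (verts ?H)" unfolding H(2) using sub subV by fast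
      then show "finite (edges ?H)" by (rule finite_subset) (use fin in simp)
      fix f assume "f \<in> edges ?H"
      then obtain e where e: "e \<in> edges G" "f \<in> ?M e" unfolding H(2) by blast
      show "inc ?H f \<subseteq> verts ?H" unfolding H(3) using sub[OF e(2)] subV[OF e(1)] by (rule subset_trans)
      show "2 \<le> card (inc ?H f)" unfolding H(3) using card2[OF e(2)] by simp
    qed
    show "?X u \<inter> ?X v = {}" if "u \<noteq> v" for u v using that by auto
    show "verts ?H = (\<Union>v\<in>verts G. ?X v)" by (rule H(1))
    show "independent ?H (?X v)" if v: "v \<in> verts G" for v
    proof -
      have "\<not> f \<subseteq> ?X v" if f: "f \<in> edges ?H" for f
      proof
        assume fX: "f \<subseteq> ?X v"
        obtain e where e: "e \<in> edges G" "f \<in> ?M e" using f unfolding H(2) by blast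
        obtain u \<beta> i w \<gamma> j where "f = {(u, \<beta>, i), (w, \<gamma>, j)}" "u \<noteq> w"
          using e(2) unfolding block_matching_def by blast
        then show False using fX by auto
      qed
      then show ?thesis unfolding independent_def induced_def using v H by auto
    qed
    show "\<exists>M. (\<forall>e \<in> edges G. matching (induced ?H (\<Union>v \<in> inc G e. ?X v)) (M e) \<and>
              (\<forall>f \<in> M e. \<forall>v \<in> inc G e. card (inc ?H f \<inter> ?X v) = 1)) \<and>
          edges ?H = (\<Union>e \<in> edges G. M e)"
    proof (intro exI[of _ ?M] conjI ballI)
      fix e assume e: "e \<in> edges G"
      show "matching (induced ?H (\<Union>v \<in> inc G e. ?X v)) (?M e)"
        unfolding matching_def
      proof (intro conjI ballI impI)
        show "?M e \<subseteq> edges (induced ?H (\<Union>v \<in> inc G e. ?X v))"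
          unfolding induced_def using sub e H by auto
        show "inc (induced ?H (\<Union>v \<in> inc G e. ?X v)) f \<inter> inc (induced ?H (\<Union>v \<in> inc G e. ?X v)) g = {}"
          if "f \<in> ?M e" "g \<in> ?M e" "f \<noteq> g" for f g
          using disj[OF that e] by (simp add: induced_def H)
      qed
      show "card (inc ?H f \<inter> ?X v) = 1" if "f \<in> ?M e" "v \<in> inc G e" for f v
        unfolding H(3) using inter[OF that] .
    qed (rule H(2))
  qed
qed

lemma block_cover_choice:
  assumes col: "cover_colorable G (\<lambda>v. {v} \<times> {..<b} \<times> {..<t}) (block_cover G b t idx s)"
  obtains \<beta> i where "\<And>v. v \<in> verts G \<Longrightarrow> \<beta> v < b \<and> i v < t"
    and "\<And>e u v. e \<in> edges G \<Longrightarrow> inc G e = {u, v} \<Longrightarrow> u \<noteq> v \<Longrightarrow> (i u + i v) mod t = idx e \<Longrightarrow>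
      (\<beta> u = \<beta> v) \<noteq> s e"
proof -
  let ?X = "\<lambda>v. {v} \<times> {..<b} \<times> {..<t}"
  let ?H = "block_cover G b t idx s"
  obtain T where T: "independent ?H T" "\<forall>v\<in>verts G. card (T \<inter> ?X v) = 1"
    using col unfolding cover_colorable_def by blast
  have "\<exists>p. (v, p) \<in> T \<and> fst p < b \<and> snd p < t" if "v \<in> verts G" for v
  proof -
    have "T \<inter> ?X v \<noteq> {}" using T(2) that by (metis card.empty zero_neq_one)
    then show ?thesis by auto
  qed
  then obtain p where p: "\<And>v. v \<in> verts G \<Longrightarrow> (v, p v) \<in> T \<and> fst (p v) < b \<and> snd (p v) < t" by metis
  have "(fst (p u) = fst (p v)) \<noteq> s e"
    if e: "e \<in> edges G" "inc G e = {u, v}" "u \<noteq> v" "(snd (p u) + snd (p v)) mod t = idx e" for e u v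
  proof
    assume eq: "(fst (p u) = fst (p v)) = s e"
    have uv: "u \<in> verts G" "v \<in> verts G" using inc_subset e by auto
    let ?f = "{(u, fst (p u), snd (p u)), (v, fst (p v), snd (p v))}"
    have "?f \<in> block_matching G b t idx s e"
      unfolding block_matching_def using e eq p[OF uv(1)] p[OF uv(2)] by blast
    then have "?f \<in> edges ?H" using e by (auto simp: block_cover_def)
    moreover have "inc ?H ?f \<subseteq> T" using p uv by (simp add: block_cover_def)
    ultimately show False using T(1) unfolding independent_def induced_def by auto
  qed
  with p show thesis using that[of "\<lambda>v. fst (p v)" "\<lambda>v. snd (p v)"] by blast
qed

text \<open>The parallel edges over \<open>{x, y}\<close> carry all \<open>t\<close> indices, so
  whatever second components are chosen at the ends, one of these edges has the fitting index and
  imposes its block condition. A coloring thus yields a labeling of the simple graph by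
  \<open>b\<close> blocks; classes of size \<open>b * t\<close> are large enough for the maximum
  degree.\<close>

lemma multiple_graph_lower_bound:
  assumes iso: "hypergraph_iso G (multiple_graph t V F)" and finF: "finite F"
    and F: "\<And>A. A \<in> F \<Longrightarrow> card A = 2 \<and> A \<subseteq> V" and deg: "\<And>x. x \<in> V \<Longrightarrow> card {A \<in> F. x \<in> A} \<le> b"
    and s: "b = 2 \<or> (\<forall>A\<in>F. s A)" and col: "dp_colorable G (max_degree G)"
  shows "\<exists>\<beta>. (\<forall>x\<in>V. \<beta> x < b) \<and> (\<forall>x y. {x, y} \<in> F \<longrightarrow> x \<noteq> y \<longrightarrow> (\<beta> x = \<beta> y) \<noteq> s {x, y})"
proof -
  obtain \<phi> \<psi> where \<phi>: "bij_betw \<phi> (verts G) V" and \<psi>: "bij_betw \<psi> (edges G) (F \<times> {..<t})"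
    and inc: "\<And>e. e \<in> edges G \<Longrightarrow> fst (\<psi> e) = \<phi> ` inc G e"
    using iso unfolding hypergraph_iso_def multiple_graph_def by auto
  have inj: "inj_on \<phi> (verts G)" and V: "\<phi> ` verts G = V" using \<phi> by (auto simp: bij_betw_def)
  have \<psi>F: "fst (\<psi> e) \<in> F" "snd (\<psi> e) < t" if "e \<in> edges G" for e
  proof -
    have "\<psi> e \<in> F \<times> {..<t}" using \<psi> that by (auto simp: bij_betw_def)
    then show "fst (\<psi> e) \<in> F" "snd (\<psi> e) < t" by (auto simp: mem_Times_iff)
  qed
  have two: "card (inc G e) = 2" if e: "e \<in> edges G" for e
  proof -
    have "card (\<phi> ` inc G e) = card (inc G e)"
      by (rule card_image, rule inj_on_subset[OF inj inc_subset[OF e]])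
    then show ?thesis using F[OF \<psi>F(1)[OF e]] inc[OF e] by simp
  qed
  have "max_degree G \<le> b * t"
  proof (rule max_degree_le)
    fix v assume v: "v \<in> verts G"
    have "\<psi> ` {e \<in> edges G. v \<in> inc G e} \<subseteq> {A \<in> F. \<phi> v \<in> A} \<times> {..<t}"
    proof (rule image_subsetI)
      fix e assume e: "e \<in> {e \<in> edges G. v \<in> inc G e}"
      then have "\<phi> v \<in> fst (\<psi> e)" using inc[of e] by simp
      then show "\<psi> e \<in> {A \<in> F. \<phi> v \<in> A} \<times> {..<t}" using \<psi>F[of e] e by (simp add: mem_Times_iff)
    qed
    moreover have "inj_on \<psi> {e \<in> edges G. v \<in> inc G e}"
      using \<psi> by (auto simp: bij_betw_def intro: inj_on_subset)
    ultimately have "degree G v \<le> card ({A \<in> F. \<phi> v \<in> A} \<times> {..<t})"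
      unfolding degree_def using finF by (intro card_inj_on_le) auto
    also have "\<dots> \<le> b * t" using deg[of "\<phi> v"] V v by (auto simp: card_cartesian_product)
    finally show "degree G v \<le> b * t" .
  qed
  then have "cover_colorable G (\<lambda>v. {v} \<times> {..<b} \<times> {..<t})
      (block_cover G b t (\<lambda>e. snd (\<psi> e)) (\<lambda>e. s (fst (\<psi> e))))"
    by (intro dp_colorable_any_cover[OF hypergraph_axioms col] block_cover_is_cover)
      (use s \<psi>F two in \<open>auto simp: card_cartesian_product\<close>)
  then obtain \<beta> i where bi: "\<And>v. v \<in> verts G \<Longrightarrow> \<beta> v < b \<and> i v < t"
    and ne: "\<And>e u v. e \<in> edges G \<Longrightarrow> inc G e = {u, v} \<Longrightarrow> u \<noteq> v \<Longrightarrow> (i u + i v) mod t = snd (\<psi> e) \<Longrightarrow>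
      (\<beta> u = \<beta> v) \<noteq> s (fst (\<psi> e))"
    by (rule block_cover_choice) blast
  define g where "g = the_inv_into (verts G) \<phi>"
  have g: "g x \<in> verts G" "\<phi> (g x) = x" if "x \<in> V" for x
    using the_inv_into_into[OF inj] f_the_inv_into_f[OF inj] V that by (auto simp: g_def)
  have "(\<beta> (g x) = \<beta> (g y)) \<noteq> s {x, y}" if xy: "{x, y} \<in> F" "x \<noteq> y" for x y
  proof -
    have xyV: "x \<in> V" "y \<in> V" using F[OF xy(1)] by auto
    have ne': "g x \<noteq> g y" using g xyV xy(2) by metis
    have "i (g x) < t" using bi g xyV by blast
    then have "({x, y}, (i (g x) + i (g y)) mod t) \<in> F \<times> {..<t}" using xy by simp
    then have "({x, y}, (i (g x) + i (g y)) mod t) \<in> \<psi> ` edges G" using \<psi> by (simp add: bij_betw_def)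
    then obtain e where e: "e \<in> edges G" "\<psi> e = ({x, y}, (i (g x) + i (g y)) mod t)" by force
    have "\<phi> ` inc G e = \<phi> ` {g x, g y}" using inc[OF e(1)] e(2) g xyV by simp
    then have "inc G e = {g x, g y}"
      using inj_on_image_eq_iff[OF inj inc_subset[OF e(1)], of "{g x, g y}"] g xyV by blast
    from ne[OF e(1) this ne'] show ?thesis using e(2) by simp
  qed
  then show ?thesis using bi g by (intro exI[of _ "\<lambda>x. \<beta> (g x)"]) blast
qed

text \<open>With \<open>n - 1\<close> blocks and equal blocks forbidden on every edge, the labeling
  would be an injection from \<open>n\<close> vertices into \<open>n - 1\<close> blocks. For
  \<open>n = 1\<close> the color class is empty.\<close>

lemma tK_not_dp_colorable:
  assumes iso: "hypergraph_iso G (tK t n)" and n: "n \<ge> 1"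
  shows "\<not> dp_colorable G (max_degree G)"
proof
  assume col: "dp_colorable G (max_degree G)"
  let ?F = "{{i, j} |i j. i < n \<and> j < n \<and> i \<noteq> j}"
  have "?F \<subseteq> Pow {..<n}" by auto
  then have fin: "finite ?F" by (rule finite_subset) simp
  have F: "card A = 2 \<and> A \<subseteq> {..<n}" if "A \<in> ?F" for A
    using that by auto
  have deg: "card {A \<in> ?F. x \<in> A} \<le> n - 1" if "x \<in> {..<n}" for x
  proof -
    have "{A \<in> ?F. x \<in> A} \<subseteq> (\<lambda>j. {x, j}) ` ({..<n} - {x})" by auto
    then have "card {A \<in> ?F. x \<in> A} \<le> card ({..<n} - {x})" by (intro surj_card_le) auto
    then show ?thesis using that by simp
  qed
  obtain \<beta> where \<beta>: "\<forall>x\<in>{..<n}. \<beta> x < n - 1"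
    "\<And>x y. {x, y} \<in> ?F \<Longrightarrow> x \<noteq> y \<Longrightarrow> (\<beta> x = \<beta> y) \<noteq> True"
    using multiple_graph_lower_bound[OF iso[unfolded tK_def] fin F deg _ col, of "\<lambda>_. True"] by blast
  have "inj_on \<beta> {..<n}"
  proof (rule inj_onI, rule ccontr)
    fix x y assume "x \<in> {..<n}" "y \<in> {..<n}" "\<beta> x = \<beta> y" "x \<noteq> y"
    then show False using \<beta>(2)[of x y] by blast
  qed
  then have "card {..<n} \<le> card {..<n - 1}" by (rule card_inj_on_le) (use \<beta>(1) in auto)
  then show False using n by simp
qed

text \<open>All edges of the cycle but one force equal blocks, and the last one forces different blocks.\<close>

lemma tC_not_dp_colorable:
  assumes iso: "hypergraph_iso G (tC t n)" and n: "n \<ge> 3"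
  shows "\<not> dp_colorable G (max_degree G)"
proof
  assume col: "dp_colorable G (max_degree G)"
  let ?F = "{{i, Suc i mod n} |i. i < n}"
  let ?s = "\<lambda>A. A = {n - 1, 0}"
  have ne: "i \<noteq> Suc i mod n" if "i < n" for i
    using that n by (cases "Suc i = n") auto
  have F: "card A = 2 \<and> A \<subseteq> {..<n}" if A: "A \<in> ?F" for A
  proof -
    obtain i where i: "A = {i, Suc i mod n}" "i < n" using A by blast
    have "Suc i mod n < n" using i by simp
    then show ?thesis using i ne[OF i(2)] by simp
  qed
  have "?F = (\<lambda>i. {i, Suc i mod n}) ` {..<n}" by auto
  then have fin: "finite ?F" by simp
  have deg: "card {A \<in> ?F. x \<in> A} \<le> 2" if "x \<in> {..<n}" for x
  proof -
    have "A \<in> {{x, Suc x mod n}, {if x = 0 then n - 1 else x - 1, x}}" if A: "A \<in> ?F" "x \<in> A" for A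
    proof -
      obtain i where i: "A = {i, Suc i mod n}" "i < n" using A by blast
      then consider "x = i" | "x = Suc i mod n" using A(2) by blast
      then show ?thesis
      proof cases
        case 2
        then have "i = (if x = 0 then n - 1 else x - 1)"
          using i(2) by (cases "Suc i = n") auto
        then show ?thesis using i 2 by simp
      qed (use i in simp)
    qed
    then have "{A \<in> ?F. x \<in> A} \<subseteq> {{x, Suc x mod n}, {if x = 0 then n - 1 else x - 1, x}}" by blast
    then have "card {A \<in> ?F. x \<in> A} \<le> card {{x, Suc x mod n}, {if x = 0 then n - 1 else x - 1, x}}"
      by (intro card_mono) auto
    also have "\<dots> \<le> 2" by (simp add: card_insert_if)
    finally show ?thesis .
  qed
  obtain \<beta> :: "nat \<Rightarrow> nat"
    where \<beta>: "\<And>x y. {x, y} \<in> ?F \<Longrightarrow> x \<noteq> y \<Longrightarrow> (\<beta> x = \<beta> y) \<noteq> ?s {x, y}"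
    using multiple_graph_lower_bound[OF iso[unfolded tC_def] fin F deg _ col, of ?s] by blast
  have step: "\<beta> (Suc i) = \<beta> i" if "Suc i < n" for i
  proof -
    have "{i, Suc i} \<in> ?F" using that by (auto intro!: exI[of _ i])
    moreover have "\<not> ?s {i, Suc i}" using n by (auto simp: doubleton_eq_iff)
    ultimately show ?thesis using \<beta>[of i "Suc i"] by simp
  qed
  have const: "\<beta> i = \<beta> 0" if "i < n" for i
    using that by (induction i) (use step in auto)
  have "{n - 1, 0} \<in> ?F" using n by (intro CollectI exI[of _ "n - 1"]) simp
  then have "\<beta> (n - 1) \<noteq> \<beta> 0" using \<beta>[of "n - 1" 0] n by simp
  then show False using const[of "n - 1"] n by simp
qed

text \<open>The hypergraph covers itself with one color per vertex, and the only transversal is the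
  whole vertex set, which contains the edge.\<close>

lemma single_edge_not_dp_colorable:
  assumes e: "edges G = {e}" "verts G = inc G e"
  shows "\<not> dp_colorable G (max_degree G)"
proof
  assume col: "dp_colorable G (max_degree G)"
  have "is_cover G (\<lambda>v. {v}) G"
    unfolding is_cover_def
  proof (intro conjI ballI impI exI[of _ "\<lambda>e. {e}"])
    show "hypergraph G" by (rule hypergraph_axioms)
    show "independent G {v}" if "v \<in> verts G" for v
    proof -
      have "\<not> inc G e \<subseteq> {v}" using card_inc[of e] e(1) card_mono[of "{v}" "inc G e"] by auto
      then show ?thesis using that e(1) by (simp add: independent_def induced_def)
    qed
    show "matching (induced G (\<Union>v\<in>inc G f. {v})) {f}" if "f \<in> edges G" for f
      using that by (simp add: matching_def induced_def)
  qed auto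
  moreover have "max_degree G \<le> 1"
  proof (rule max_degree_le)
    fix v
    have "degree G v \<le> card (edges G)" unfolding degree_def using finite_edges by (intro card_mono) auto
    then show "degree G v \<le> 1" using e(1) by simp
  qed
  ultimately have "cover_colorable G (\<lambda>v. {v}) G"
    by (intro dp_colorable_any_cover[OF hypergraph_axioms col]) simp_all
  then obtain T where T: "independent G T" "\<forall>v\<in>verts G. card (T \<inter> {v}) = 1"
    unfolding cover_colorable_def by blast
  have "verts G \<subseteq> T"
  proof (rule subsetI, rule ccontr)
    fix v assume "v \<in> verts G" "v \<notin> T"
    then show False using T(2) by (metis Int_insert_right_if0 Int_empty_right card.empty zero_neq_one)
  qed
  then show False using T(1) e by (auto simp: independent_def induced_def)
qed

lemma dp_hyperbrick_not_dp_colorable: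
  assumes "dp_hyperbrick G"
  shows "\<not> dp_colorable G (max_degree G)"
  using assms tK_not_dp_colorable tC_not_dp_colorable single_edge_not_dp_colorable
  unfolding dp_hyperbrick_def by blast

end

text \<open>This lets failure at \<open>max_degree G\<close> rule out all smaller numbers as
  well.\<close>

lemma dp_colorable_mono: "dp_colorable G k \<Longrightarrow> k \<le> l \<Longrightarrow> dp_colorable G l"
  unfolding dp_colorable_def by (meson order_trans)

theorem theorem10:
  fixes G :: "('v, 'e) hypergraph_rec"
  assumes "hypergraph G"
    and "connected_hypergraph G"
  shows "dp_chromatic_number G \<le> max_degree G + 1 \<and>
         (dp_chromatic_number G = max_degree G + 1 \<longleftrightarrow> dp_hyperbrick G)"
proof -
  interpret hypergraph G by (rule assms(1))
  have up: "dp_colorable G (max_degree G + 1)" by (rule dp_colorable_Suc_max_degree)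
  then have le: "dp_chromatic_number G \<le> max_degree G + 1"
    unfolding dp_chromatic_number_def by (rule Least_le)
  have least: "dp_colorable G (dp_chromatic_number G)"
    unfolding dp_chromatic_number_def using up by (rule LeastI)
  have "dp_chromatic_number G = max_degree G + 1 \<longleftrightarrow> \<not> dp_colorable G (max_degree G)"
  proof
    assume eq: "dp_chromatic_number G = max_degree G + 1"
    show "\<not> dp_colorable G (max_degree G)"
    proof
      assume "dp_colorable G (max_degree G)"
      then have "dp_chromatic_number G \<le> max_degree G"
        unfolding dp_chromatic_number_def by (rule Least_le)
      then show False using eq by simp
    qed
  next
    assume n: "\<not> dp_colorable G (max_degree G)"
    have "\<not> dp_chromatic_number G \<le> max_degree G"
      using dp_colorable_mono[OF least] n by blast
    then show "dp_chromatic_number G = max_degree G + 1" using le by simp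
  qed
  moreover have "\<not> dp_colorable G (max_degree G) \<longleftrightarrow> dp_hyperbrick G"
    using not_dp_colorable_brick[OF assms(2)] brick_dp_hyperbrick dp_hyperbrick_not_dp_colorable
    by blast
  ultimately show ?thesis using le by simp
qed

end
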